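(* Let $\kappa_1<\kappa_2$ be nonzero reals and $a>0$, and let $G$ be the Green function defined in the context. There is a constant $C$ (depending only on $\kappa_1,\kappa_2,a$) such that for all $x,x'\in\mathbb R^2$ with $x_2-x_2'\ne0$ and all $\lambda\in\mathbb C$ with $\lambda\ne\kappa_1,\kappa_2$, $$|G(x,x',\lambda)|\le C\Big(1+\frac1{\sqrt{|x_2-x_2'|}}\Big),$$ and for any Schwartz function $f$ on $\mathbb R^2$ and each fixed $\lambda\ne\kappa_1,\kappa_2$, $$\lim_{|x|\to\infty}G\ast f(x,\lambda)=0,\qquad G\ast f(x,\lambda)=\iint G(x,x',\lambda)f(x')\,dx',\quad dx'=dx_1'dx_2'.$$
   Context: Notation. $x=(x_1,x_2)\in\mathbb R^2$, $|x|=|x_1|+|x_2|$. For $\lambda\in\mathbb C$, $\lambda=\lambda_R+i\lambda_I$. $\theta$ without index is the Heaviside function; $\theta_j(x)=\kappa_jx_1+\kappa_j^2x_2$, $j=1,2$. Sato functions. $$\chi(x,\lambda)=\frac{(1-\frac{\kappa_1}{\lambda})e^{\theta_1(x)}+(1-\frac{\kappa_2}{\lambda})ae^{\theta_2(x)}}{e^{\theta_1(x)}+ae^{\theta_2(x)}},\qquad \xi(x,\lambda)=\frac{\frac{e^{\theta_1(x)}}{1-\kappa_1/\lambda}+\frac{ae^{\theta_2(x)}}{1-\kappa_2/\lambda}}{e^{\theta_1(x)}+ae^{\theta_2(x)}},$$ $\varphi(x,\lambda)=e^{\lambda x_1+\lambda^2x_2}\chi(x,\lambda)$, $\psi(x,\lambda)=e^{-(\lambda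 x_1+\lambda^2x_2)}\xi(x,\lambda)$, $\varphi_j(x)=\varphi(x,\kappa_j)$, $\psi_j(x)=\mathrm{res}_{\lambda=\kappa_j}\psi(x,\lambda)$. Green function. $G(x,x',\lambda)=e^{-\lambda(x_1-x_1')-\lambda^2(x_2-x_2')}(\mathcal G_c+\mathcal G_d)(x,x',\lambda)$, where $$\mathcal G_c=-\frac{\mathrm{sgn}(x_2-x_2')}{2\pi}\int_{\mathbb R}\theta\big((s^2-\lambda_I^2)(x_2-x_2')\big)\varphi(x,\lambda_R+is)\psi(x',\lambda_R+is)\,ds,$$ $$\mathcal G_d=-\theta(x_2'-x_2)\sum_{j=1}^2\theta(\lambda_R-\kappa_j)\varphi_j(x)\psi_j(x').$$ The product $\varphi(x,\cdot)\psi(x',\cdot)$ has a removable singularity at $0$; values of $G$ on the lines $\lambda_R=\kappa_j$ ($\lambda\ne\kappa_j$) are understood by continuity in $\lambda$. $G$ satisfies $LG=\delta(x-x')$ with $L=-\partial_{x_2}+\partial_{x_1}^2+2\lambda\partial_{x_1}+u_0(x)$ and $u_0(x)=\frac{(\kappa_1-\kappa_2)^2}{2}\mathrm{sech}^2\frac{\theta_1(x)-\theta_2(x)-\ln a}{2}$. *)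

theory Defs
  imports "HOL-Complex_Analysis.Complex_Analysis"
begin

text \<open>
  Points of the plane are pairs; \<open>k1\<close>, \<open>k2\<close> and \<open>a\<close> stand for
  \<open>\<kappa>\<^sub>1\<close>, \<open>\<kappa>\<^sub>2\<close> and \<open>a\<close>.
\<close>

section \<open>Sato functions\<close>

definition theta_phase :: "real \<Rightarrow> real \<times> real \<Rightarrow> real" where
  "theta_phase k x = k * fst x + k\<^sup>2 * snd x"

definition sato_chi :: "real \<Rightarrow> real \<Rightarrow> real \<Rightarrow> real \<times> real \<Rightarrow> complex \<Rightarrow> complex" where
  "sato_chi k1 k2 a x l =
     ((1 - of_real k1 / l) * of_real (exp (theta_phase k1 x))
        + (1 - of_real k2 / l) * of_real (a * exp (theta_phase k2 x)))
     / of_real (exp (theta_phase k1 x) + a * exp (theta_phase k2 x))"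

definition sato_xi :: "real \<Rightarrow> real \<Rightarrow> real \<Rightarrow> real \<times> real \<Rightarrow> complex \<Rightarrow> complex" where
  "sato_xi k1 k2 a x l =
     (of_real (exp (theta_phase k1 x)) / (1 - of_real k1 / l)
        + of_real (a * exp (theta_phase k2 x)) / (1 - of_real k2 / l))
     / of_real (exp (theta_phase k1 x) + a * exp (theta_phase k2 x))"

definition sato_phi :: "real \<Rightarrow> real \<Rightarrow> real \<Rightarrow> real \<times> real \<Rightarrow> complex \<Rightarrow> complex" where
  "sato_phi k1 k2 a x l =
     exp (l * of_real (fst x) + l\<^sup>2 * of_real (snd x)) * sato_chi k1 k2 a x l"

definition sato_psi :: "real \<Rightarrow> real \<Rightarrow> real \<Rightarrow> real \<times> real \<Rightarrow> complex \<Rightarrow> complex" where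
  "sato_psi k1 k2 a x l =
     exp (- (l * of_real (fst x) + l\<^sup>2 * of_real (snd x))) * sato_xi k1 k2 a x l"

text \<open>
  \<open>\<phi>\<^sub>j\<close> and \<open>\<psi>\<^sub>j\<close> are the following two functions at \<open>k = \<kappa>\<^sub>j\<close>.
\<close>

definition phi_at :: "real \<Rightarrow> real \<Rightarrow> real \<Rightarrow> real \<Rightarrow> real \<times> real \<Rightarrow> complex" where
  "phi_at k1 k2 a k x = sato_phi k1 k2 a x (of_real k)"

definition psi_res :: "real \<Rightarrow> real \<Rightarrow> real \<Rightarrow> real \<Rightarrow> real \<times> real \<Rightarrow> complex" where
  "psi_res k1 k2 a k x = residue (sato_psi k1 k2 a x) (of_real k)"

section \<open>Green function\<close>

text \<open>
  The value at \<open>0\<close> is immaterial: for \<open>x\<^sub>2 \<noteq> x\<^sub>2'\<close> it only affects a null set of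
  integration variables, or the lines \<open>\<lambda>\<^sub>R = \<kappa>\<^sub>j\<close>, where the formula below is not used.
\<close>

definition heaviside :: "real \<Rightarrow> real" where
  "heaviside t = (if t > 0 then 1 else 0)"

text \<open>
  The removable singularity of \<open>\<phi>(x,\<cdot>)\<psi>(x',\<cdot>)\<close> at \<open>0\<close> can be met by the integration
  variable only at the single point \<open>s = 0\<close>, so the value there plays no role.
\<close>

definition green_cont ::
  "real \<Rightarrow> real \<Rightarrow> real \<Rightarrow> real \<times> real \<Rightarrow> real \<times> real \<Rightarrow> complex \<Rightarrow> complex" where
  "green_cont k1 k2 a x x' l =
     - of_real (sgn (snd x - snd x') / (2 * pi)) *
       (\<integral>s. of_real (heaviside ((s\<^sup>2 - (Im l)\<^sup>2) * (snd x - snd x')))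
             * sato_phi k1 k2 a x (Complex (Re l) s)
             * sato_psi k1 k2 a x' (Complex (Re l) s) \<partial>lborel)"

definition green_disc ::
  "real \<Rightarrow> real \<Rightarrow> real \<Rightarrow> real \<times> real \<Rightarrow> real \<times> real \<Rightarrow> complex \<Rightarrow> complex" where
  "green_disc k1 k2 a x x' l =
     - of_real (heaviside (snd x' - snd x)) *
       (of_real (heaviside (Re l - k1)) * phi_at k1 k2 a k1 x * psi_res k1 k2 a k1 x'
        + of_real (heaviside (Re l - k2)) * phi_at k1 k2 a k2 x * psi_res k1 k2 a k2 x')"

definition green_formula ::
  "real \<Rightarrow> real \<Rightarrow> real \<Rightarrow> real \<times> real \<Rightarrow> real \<times> real \<Rightarrow> complex \<Rightarrow> complex" where
  "green_formula k1 k2 a x x' l =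
     exp (- l * of_real (fst x - fst x') - l\<^sup>2 * of_real (snd x - snd x'))
       * (green_cont k1 k2 a x x' l + green_disc k1 k2 a x x' l)"

text \<open>
  On the lines \<open>\<lambda>\<^sub>R = \<kappa>\<^sub>j\<close> (where the path of integration can pass through a pole of
  \<open>\<psi>(x',\<cdot>)\<close> and the discrete part jumps) the Green function is defined by continuity in
  \<open>\<lambda>\<close>, that is, as the limit of the formula from the complement of the two lines.
\<close>

definition green ::
  "real \<Rightarrow> real \<Rightarrow> real \<Rightarrow> real \<times> real \<Rightarrow> real \<times> real \<Rightarrow> complex \<Rightarrow> complex" where
  "green k1 k2 a x x' l =
     (if Re l \<noteq> k1 \<and> Re l \<noteq> k2 then green_formula k1 k2 a x x' l
      else Lim (at l within {m. Re m \<noteq> k1 \<and> Re m \<noteq> k2}) (green_formula k1 k2 a x x'))"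

section \<open>Schwartz functions\<close>

text \<open>
  Iterated partial derivatives are indexed by lists of coordinate directions. Asking all of
  them to be (totally) differentiable is smoothness; the last conjunct is rapid decay of every
  derivative.
\<close>

definition partial_deriv ::
  "'a::euclidean_space \<Rightarrow> ('a \<Rightarrow> 'b::real_normed_vector) \<Rightarrow> 'a \<Rightarrow> 'b" where
  "partial_deriv v f x = frechet_derivative f (at x) v"

definition schwartz :: "('a::euclidean_space \<Rightarrow> 'b::real_normed_vector) \<Rightarrow> bool" where
  "schwartz f \<longleftrightarrow>
     (\<forall>vs. set vs \<subseteq> Basis \<longrightarrow>
        foldr partial_deriv vs f differentiable_on UNIV \<and>
        (\<forall>N::nat. bounded (range (\<lambda>x. norm x ^ N *\<^sub>R foldr partial_deriv vs f x))))"

end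

theory Submission
  imports Defs "HOL-Probability.Probability"
begin

text \<open>
  With \<open>y = x\<^sub>2 - x\<^sub>2'\<close>, \<open>w = x\<^sub>1 - x\<^sub>1' + 2 \<lambda>\<^sub>R y\<close> and \<open>c\<^sub>j = \<lambda>\<^sub>R - \<kappa>\<^sub>j\<close>, a partial fraction
  expansion of \<open>\<chi>(x,\<cdot>)\<xi>(x',\<cdot>)\<close> reduces the Green function to \<open>\<integral> env(s) e\<^sup>i\<^sup>s\<^sup>w ds\<close> and
  \<open>\<integral> env(s) e\<^sup>i\<^sup>s\<^sup>w / (c\<^sub>j + i s) ds\<close>, where \<open>env\<close> is a Gaussian cut off at \<open>\<bar>s\<bar> = \<bar>\<lambda>\<^sub>I\<bar>\<close>, with
  coefficients bounded by \<open>\<kappa>\<^sub>2 - \<kappa>\<^sub>1\<close>. The integrals are bounded uniformly in the poles because the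
  even part of \<open>e\<^sup>i\<^sup>s\<^sup>w / (c + i s)\<close> has uniformly bounded partial integrals (Cauchy density, sine
  integral), a property that survives multiplication by bounded monotone functions (second mean
  value theorem). The two discrete terms are unbounded, but \<open>\<Sum>\<^sub>j \<phi>\<^sub>j(x)\<psi>\<^sub>j(x') = 0\<close>, so only the range
  \<open>\<kappa>\<^sub>1 < \<lambda>\<^sub>R < \<kappa>\<^sub>2\<close> matters, and there either term can be replaced by the other one.

  For fixed \<open>\<lambda>\<close> both \<open>\<bar>G\<bar> \<bar>y\<bar>\<^bsup>1/2\<^esup>\<close> and \<open>\<bar>G\<bar> \<bar>w\<bar>\<close> are bounded. When \<open>y < 0\<close> and \<open>\<lambda>\<^sub>I \<noteq> 0\<close> this is seen by
  rotating the segment of integration into two vertical half-lines: the residue picked up is exactly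
  the discrete term, which also shows that the formula extends continuously across the lines
  \<open>\<lambda>\<^sub>R = \<kappa>\<^sub>j\<close>. Hence \<open>\<bar>G\<bar>\<close> is small outside a bounded set of differences \<open>x - x'\<close>, where it is integrable,
  and the convolution with a function that is integrable and vanishes at infinity tends to 0.
\<close>

section \<open>Functions with bounded partial integrals\<close>

lemma gauss_integrable:
  fixes b m :: real assumes "b > 0"
  shows "integrable lborel (\<lambda>s. exp (- (b * (s - m)\<^sup>2)))"
    and "(\<integral>s. exp (- (b * (s - m)\<^sup>2)) \<partial>lborel) = sqrt (pi / b)"
proof -
  define \<sigma> where "\<sigma> = 1 / sqrt (2 * b)"
  have s: "\<sigma> > 0" and s2: "\<sigma>\<^sup>2 = 1 / (2 * b)"
    using assms by (auto simp: \<sigma>_def power_divide)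
  have eq: "exp (- (b * (s - m)\<^sup>2)) = sqrt (pi / b) * normal_density m \<sigma> s" for s
    unfolding normal_density_def s2 using assms by (simp add: field_simps)
  show "integrable lborel (\<lambda>s. exp (- (b * (s - m)\<^sup>2)))"
    unfolding eq using s by (intro integrable_mult_right) auto
  show "(\<integral>s. exp (- (b * (s - m)\<^sup>2)) \<partial>lborel) = sqrt (pi / b)"
    unfolding eq using s by simp
qed

text \<open>The cut-off keeps exactly the points where the exponential is below 1:
  \<open>|s| > L\<close> for \<open>y > 0\<close> and \<open>|s| < L\<close> for
  \<open>y < 0\<close>.\<close>

definition env :: "real \<Rightarrow> real \<Rightarrow> real \<Rightarrow> real" where
  "env y L s = heaviside ((s\<^sup>2 - L\<^sup>2) * y) * exp (- ((s\<^sup>2 - L\<^sup>2) * y))"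

lemma env_nonneg: "0 \<le> env y L s"
  by (simp add: env_def heaviside_def)

lemma env_even [simp]: "env y L (- s) = env y L s"
  by (simp add: env_def)

lemma borel_measurable_heaviside [measurable]: "heaviside \<in> borel_measurable borel"
  unfolding heaviside_def by measurable

lemma borel_measurable_env [measurable]: "env y L \<in> borel_measurable borel"
  unfolding env_def by measurable

text \<open>For \<open>s \<ge> 0\<close> one has \<open>|s - L| \<le> |s + L|\<close>, hence
  \<open>(s - L)^2 \<le> |s^2 - L^2|\<close>; evenness covers \<open>s < 0\<close>. The two
  Gaussians have a mass independent of \<open>L\<close>, which makes later bounds uniform in the
  imaginary part of the spectral parameter.\<close>

lemma env_le_gauss:
  assumes "L \<ge> 0"
  shows "env y L s \<le> exp (- (\<bar>y\<bar> * (s - L)\<^sup>2)) + exp (- (\<bar>y\<bar> * (s - (- L))\<^sup>2))"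
proof -
  have *: "env y L s \<le> exp (- (\<bar>y\<bar> * (s - L)\<^sup>2))" if "s \<ge> 0" for s
  proof (cases "(s\<^sup>2 - L\<^sup>2) * y > 0")
    case True
    have "\<bar>s - L\<bar> * \<bar>s - L\<bar> \<le> \<bar>s - L\<bar> * \<bar>s + L\<bar>"
      using that assms by (intro mult_left_mono) auto
    hence "(s - L)\<^sup>2 \<le> \<bar>s\<^sup>2 - L\<^sup>2\<bar>"
      by (simp add: power2_eq_square square_diff_square_factored abs_mult mult.commute flip: abs_mult)
    hence "\<bar>y\<bar> * (s - L)\<^sup>2 \<le> \<bar>y\<bar> * \<bar>s\<^sup>2 - L\<^sup>2\<bar>"
      by (intro mult_left_mono) auto
    also have "\<dots> = (s\<^sup>2 - L\<^sup>2) * y"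
      using True by (simp add: abs_mult [symmetric] mult.commute)
    finally show ?thesis
      by (simp add: env_def heaviside_def)
  qed (auto simp: env_def heaviside_def)
  show ?thesis
  proof (cases "s \<ge> 0")
    case True
    then show ?thesis using *[of s] by (smt (verit) exp_gt_zero)
  next
    case False
    hence "env y L s \<le> exp (- (\<bar>y\<bar> * (- s - L)\<^sup>2))" using *[of "- s"] by simp
    also have "(- s - L)\<^sup>2 = (s - (- L))\<^sup>2" by (simp add: power2_eq_square algebra_simps)
    finally show ?thesis by (smt (verit) exp_gt_zero)
  qed
qed

lemma env_integrable:
  assumes "L \<ge> 0" "y \<noteq> 0"
  shows "integrable lborel (env y L)" and "(\<integral>s. env y L s \<partial>lborel) \<le> 2 * sqrt (pi / \<bar>y\<bar>)"
proof -
  let ?g = "\<lambda>s. exp (- (\<bar>y\<bar> * (s - L)\<^sup>2)) + exp (- (\<bar>y\<bar> * (s - (- L))\<^sup>2))"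
  have y: "\<bar>y\<bar> > 0" using assms by simp
  note g = gauss_integrable[OF y, of L] gauss_integrable[OF y, of "-L"]
  have gi: "integrable lborel ?g" using g by (intro Bochner_Integration.integrable_add) auto
  show i: "integrable lborel (env y L)"
    by (rule Bochner_Integration.integrable_bound[OF gi])
       (use env_le_gauss[OF assms(1)] env_nonneg in \<open>auto intro!: AE_I2 simp del: minus_mult_minus simp: abs_of_nonneg\<close>)
  have "(\<integral>s. env y L s \<partial>lborel) \<le> (\<integral>s. ?g s \<partial>lborel)"
    by (rule integral_mono[OF i gi]) (use env_le_gauss[OF assms(1)] in auto)
  also have "\<dots> = 2 * sqrt (pi / \<bar>y\<bar>)"
    by (subst Bochner_Integration.integral_add) (use g in auto)
  finally show "(\<integral>s. env y L s \<partial>lborel) \<le> 2 * sqrt (pi / \<bar>y\<bar>)" .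
qed

text \<open>All subintervals \<open>{u..v}\<close> are bounded, because the second mean value
  theorem returns an integral over an interior subinterval; with this form, the property survives
  repeated multiplication by monotone factors.\<close>

definition bdd_partial :: "real \<Rightarrow> real \<Rightarrow> (real \<Rightarrow> real) \<Rightarrow> bool" where
  "bdd_partial N M f \<longleftrightarrow> f integrable_on {0..N} \<and>
     (\<forall>u v. 0 \<le> u \<longrightarrow> u \<le> v \<longrightarrow> v \<le> N \<longrightarrow> \<bar>integral {u..v} f\<bar> \<le> M)"

text \<open>This is Bonnet's form of the second mean value theorem: for increasing \<open>g\<close>
  with values in \<open>[0,1]\<close> the integral over \<open>{u..v}\<close> is \<open>g v\<close>
  times an integral of \<open>f\<close> over some \<open>{c..v}\<close>, so the constant does not
  grow.\<close>

lemma bdd_partial_mono: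
  assumes f: "bdd_partial N M f" and "N \<ge> 0"
    and g: "\<And>x y. 0 \<le> x \<Longrightarrow> x \<le> y \<Longrightarrow> y \<le> N \<Longrightarrow> g x \<le> g y"
    and b: "\<And>x. 0 \<le> x \<Longrightarrow> x \<le> N \<Longrightarrow> 0 \<le> g x \<and> g x \<le> 1"
  shows "bdd_partial N M (\<lambda>x. g x * f x)"
proof -
  \<comment> \<open>Lowering the multiplier to 0 at the left end point keeps it increasing, removes
    the first of the two terms of the mean value theorem and changes the integrand at one point
    only.\<close>
  define g' where "g' u x = (if x \<le> u then 0 else g x)" for u x
  have int: "((\<lambda>x. g x * f x) integrable_on {u..v}) \<and> \<bar>integral {u..v} (\<lambda>x. g x * f x)\<bar> \<le> M"
    if uv: "0 \<le> u" "u \<le> v" "v \<le> N" for u v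
  proof -
    have fi: "f integrable_on {u..v}"
      using f uv unfolding bdd_partial_def by (auto intro: integrable_subinterval_real)
    have "g' u x \<le> g' u y" if "u \<le> x" "x \<le> y" "y \<le> v" for x y
      using that uv g[of x y] b[of y] by (auto simp: g'_def)
    from second_mean_value_theorem_full[OF fi uv(2), of "g' u", OF this]
    obtain c where c: "c \<in> {u..v}" and
      hi: "((\<lambda>x. g' u x * f x) has_integral (g' u u * integral {u..c} f + g' u v * integral {c..v} f)) {u..v}"
      by blast
    have hi2: "((\<lambda>x. g x * f x) has_integral (g' u v * integral {c..v} f)) {u..v}"
      by (rule has_integral_spike[OF _ _ hi, of "{u}", THEN has_integral_eq_rhs])
         (auto simp: g'_def)
    have "\<bar>g' u v * integral {c..v} f\<bar> \<le> 1 * M"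
      unfolding abs_mult
      by (intro mult_mono) (use f c uv b[of v] in \<open>auto simp: bdd_partial_def g'_def\<close>)
    with hi2 show ?thesis
      by (auto simp: has_integral_integrable_integral)
  qed
  from int[of 0 N] int assms(2) show ?thesis
    unfolding bdd_partial_def by auto
qed

text \<open>Here \<open>1 - g\<close> is increasing, and \<open>g f = f - (1 - g) f\<close> costs a
  factor 2.\<close>

lemma bdd_partial_antimono:
  assumes f: "bdd_partial N M f" and "N \<ge> 0"
    and g: "\<And>x y. 0 \<le> x \<Longrightarrow> x \<le> y \<Longrightarrow> y \<le> N \<Longrightarrow> g y \<le> g x"
    and b: "\<And>x. 0 \<le> x \<Longrightarrow> x \<le> N \<Longrightarrow> 0 \<le> g x \<and> g x \<le> 1"
  shows "bdd_partial N (2 * M) (\<lambda>x. g x * f x)"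
proof -
  have 1: "bdd_partial N M (\<lambda>x. (1 - g x) * f x)"
    by (rule bdd_partial_mono) (use assms in auto)
  have fi: "f integrable_on {u..v}" "(\<lambda>x. (1 - g x) * f x) integrable_on {u..v}"
    if "0 \<le> u" "v \<le> N" for u v
    using f 1 that unfolding bdd_partial_def by (auto intro: integrable_subinterval_real)
  have eq: "(\<lambda>x. g x * f x) = (\<lambda>x. f x - (1 - g x) * f x)"
    by (auto simp: algebra_simps)
  have "integral {u..v} (\<lambda>x. g x * f x) = integral {u..v} f - integral {u..v} (\<lambda>x. (1 - g x) * f x)"
    if "0 \<le> u" "v \<le> N" for u v
    unfolding eq by (rule Henstock_Kurzweil_Integration.integral_diff) (use fi that in auto)
  moreover have "(\<lambda>x. g x * f x) integrable_on {0..N}"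
    unfolding eq by (rule Henstock_Kurzweil_Integration.integrable_diff) (use fi in auto)
  ultimately show ?thesis
    using f 1 unfolding bdd_partial_def by (smt (verit) order_trans)
qed

lemma bdd_partial_add:
  assumes f: "bdd_partial N A f" and g: "bdd_partial N B g"
  shows "bdd_partial N (A + B) (\<lambda>x. f x + g x)"
proof -
  have fi: "f integrable_on {u..v}" "g integrable_on {u..v}" if "0 \<le> u" "v \<le> N" for u v
    using f g that unfolding bdd_partial_def by (auto intro: integrable_subinterval_real)
  have "integral {u..v} (\<lambda>x. f x + g x) = integral {u..v} f + integral {u..v} g"
    if "0 \<le> u" "v \<le> N" for u v
    by (rule Henstock_Kurzweil_Integration.integral_add) (use fi that in auto)
  moreover have "(\<lambda>x. f x + g x) integrable_on {0..N}"
    by (rule Henstock_Kurzweil_Integration.integrable_add) (use fi in auto)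
  ultimately show ?thesis
    using f g unfolding bdd_partial_def by (smt (verit) order_trans)
qed

lemma bdd_partial_cmult:
  assumes "bdd_partial N M f"
  shows "bdd_partial N (\<bar>k\<bar> * M) (\<lambda>x. k * f x)"
  using assms integrable_on_cmult_left[of f "{0..N}" k] unfolding bdd_partial_def
  by (auto simp: abs_mult intro!: mult_left_mono)

text \<open>On the half-line the envelope is an indicator times an exponential, both monotone in
  opposite directions; whatever the sign of \<open>y\<close>, exactly one of them is handled as
  decreasing, which gives the single factor 2.\<close>

lemma bdd_partial_env:
  assumes f: "bdd_partial N M f" and N: "N \<ge> 0" and L: "L \<ge> 0"
  shows "bdd_partial N (2 * M) (\<lambda>s. env y L s * f s)"
proof -
  \<comment> \<open>Truncation at 1 puts this factor into \<open>[0,1]\<close>; the product is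
    unchanged, since the exponential is below 1 wherever the indicator is nonzero.\<close>
  define e where "e s = min 1 (exp (- ((s\<^sup>2 - L\<^sup>2) * y)))" for s
  define i where "i s = heaviside ((s\<^sup>2 - L\<^sup>2) * y)" for s
  have eq: "env y L s * f s = e s * (i s * f s)" for s
    by (auto simp: env_def e_def i_def heaviside_def min_def)
  have sq: "s\<^sup>2 \<le> t\<^sup>2" if "0 \<le> s" "s \<le> t" for s t :: real
    using that by (simp add: power_mono)
  show ?thesis
  proof (cases "y \<ge> 0")
    case True
    have m: "(s\<^sup>2 - L\<^sup>2) * y \<le> (t\<^sup>2 - L\<^sup>2) * y" if "0 \<le> s" "s \<le> t" for s t
      using True sq[OF that] by (intro mult_right_mono) auto
    have "bdd_partial N M (\<lambda>s. i s * f s)"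
      using m by (intro bdd_partial_mono f N) (auto simp: i_def heaviside_def dest: order_less_le_trans)
    then show ?thesis unfolding eq
    proof (rule bdd_partial_antimono [OF _ N])
      show "e t \<le> e s" if "0 \<le> s" "s \<le> t" for s t
        unfolding e_def using m[OF that] by (intro min.mono) auto
    qed (auto simp: e_def)
  next
    case False
    have m: "(t\<^sup>2 - L\<^sup>2) * y \<le> (s\<^sup>2 - L\<^sup>2) * y" if "0 \<le> s" "s \<le> t" for s t
      using False sq[OF that] by (intro mult_right_mono_neg) auto
    have "bdd_partial N (2 * M) (\<lambda>s. i s * f s)"
      using m by (intro bdd_partial_antimono f N) (auto simp: i_def heaviside_def dest: order_less_le_trans)
    then show ?thesis unfolding eq
    proof (rule bdd_partial_mono [OF _ N])
      show "e s \<le> e t" if "0 \<le> s" "s \<le> t" for s t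
        unfolding e_def using m[OF that] by (intro min.mono) auto
    qed (auto simp: e_def)
  qed
qed

section \<open>Oscillatory integrals\<close>

lemma bdd_partialI:
  assumes hi: "\<And>u v. u \<le> v \<Longrightarrow> (f has_integral (F v - F u)) {u..v}"
    and b: "\<And>u v. \<bar>F v - F u\<bar> \<le> M"
  shows "bdd_partial N M f"
proof -
  have "f integrable_on {0..N}"
    using hi[of 0 N] by (cases "0 \<le> N") (auto intro: has_integral_integrable)
  moreover have "integral {u..v} f = F v - F u" if "u \<le> v" for u v
    using hi[OF that] by (rule integral_unique)
  ultimately show ?thesis using b unfolding bdd_partial_def by auto
qed

text \<open>This links the gauge integrals over \<open>{0..N}\<close> controlled by
  \<open>bdd_partial\<close> with Lebesgue integrals over the half-line.\<close>

lemma tendsto_integral_Icc_at_top: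
  fixes g :: "real \<Rightarrow> real"
  assumes i: "integrable lborel (\<lambda>s. indicator {0..} s *\<^sub>R g s)"
  shows "((\<lambda>N. integral {0..N} g) \<longlongrightarrow> (\<integral>s. indicator {0..} s *\<^sub>R g s \<partial>lborel)) at_top"
proof -
  let ?h = "\<lambda>s. indicator {0..} s *\<^sub>R g s"
  have "((\<lambda>N. \<integral>s. indicator {..N} s *\<^sub>R ?h s \<partial>lborel) \<longlongrightarrow> (\<integral>s. ?h s \<partial>lborel)) at_top"
    by (rule tendsto_integral_at_top[OF _ i]) simp
  moreover have "(\<integral>s. indicator {..N} s *\<^sub>R ?h s \<partial>lborel) = integral {0..N} g" for N
  proof -
    have eqN: "indicator {..N} s *\<^sub>R ?h s = indicator {0..N} s *\<^sub>R g s" for s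
      by (auto simp: indicator_def)
    have "integrable lborel (\<lambda>s. indicator {..N} s *\<^sub>R ?h s)"
      by (rule integrable_mult_indicator[OF _ i]) simp
    hence "set_integrable lborel {0..N} g"
      unfolding set_integrable_def eqN .
    from set_borel_integral_eq_integral(2)[OF this] show ?thesis
      unfolding eqN set_lebesgue_integral_def .
  qed
  ultimately show ?thesis by simp
qed

section \<open>Model integrands: cosine, sine, sinc and the Cauchy density\<close>

lemma bdd_partial_cos:
  assumes "w \<noteq> 0" shows "bdd_partial N (2 / \<bar>w\<bar>) (\<lambda>s. cos (s * w))"
proof -
  have hi: "((\<lambda>s. cos (s * w)) has_integral (sin (v * w) / w - sin (u * w) / w)) {u..v}" if "u \<le> v" for u v
    by (rule fundamental_theorem_of_calculus [OF that])
       (auto intro!: derivative_eq_intros assms simp: assms simp flip: has_real_derivative_iff_has_vector_derivative)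
  have "\<bar>sin (v * w) / w - sin (u * w) / w\<bar> \<le> 2 / \<bar>w\<bar>" for u v
  proof -
    have "\<bar>sin (v * w) - sin (u * w)\<bar> \<le> 2"
      using abs_sin_le_one[of "v * w"] abs_sin_le_one[of "u * w"] by linarith
    thus ?thesis by (simp add: divide_right_mono flip: diff_divide_distrib)
  qed
  thus ?thesis using hi by (intro bdd_partialI[where F = "\<lambda>v. sin (v * w) / w"]) auto
qed

lemma bdd_partial_sin:
  assumes "w \<noteq> 0" shows "bdd_partial N (2 / \<bar>w\<bar>) (\<lambda>s. sin (s * w))"
proof -
  have hi: "((\<lambda>s. sin (s * w)) has_integral (- (cos (v * w) / w) - - (cos (u * w) / w))) {u..v}" if "u \<le> v" for u v
    by (rule fundamental_theorem_of_calculus [OF that])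
       (auto intro!: derivative_eq_intros assms simp: assms simp flip: has_real_derivative_iff_has_vector_derivative)
  have "\<bar>- (cos (v * w) / w) - - (cos (u * w) / w)\<bar> \<le> 2 / \<bar>w\<bar>" for u v
  proof -
    have "\<bar>cos (u * w) - cos (v * w)\<bar> \<le> 2"
      using abs_cos_le_one[of "v * w"] abs_cos_le_one[of "u * w"] by linarith
    hence "\<bar>(cos (u * w) - cos (v * w)) / w\<bar> \<le> 2 / \<bar>w\<bar>" by (simp add: divide_right_mono)
    thus ?thesis by (simp add: diff_divide_distrib)
  qed
  thus ?thesis using hi by (intro bdd_partialI[where F = "\<lambda>v. - (cos (v * w) / w)"]) auto
qed

text \<open>An antiderivative is \<open>Si (s * w)\<close>, and the sine integral is bounded; so one
  constant serves every frequency \<open>w\<close> and every \<open>N\<close>.\<close>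

lemma bdd_partial_sinc:
  obtains M where "\<And>N w. bdd_partial N M (\<lambda>s. sin (s * w) / s)"
proof -
  obtain B where B: "\<And>T. \<bar>Si T\<bar> \<le> B" using bounded_Si by blast
  have "bdd_partial N (2 * B) (\<lambda>s. sin (s * w) / s)" for N w
  proof -
    have hi: "((\<lambda>s. sin (s * w) / s) has_integral (Si (v * w) - Si (u * w))) {u..v}" if "u \<le> v" for u v
    proof -
      have "((\<lambda>s. sinc (s * w) * w) has_integral (Si (v * w) - Si (u * w))) {u..v}"
      proof (rule fundamental_theorem_of_calculus [OF that])
        fix s assume "s \<in> {u..v}"
        have "((\<lambda>s. Si (s * w)) has_real_derivative sinc (s * w) * w) (at s within {u..v})"
          by (rule DERIV_chain2 [OF DERIV_Si]) (auto intro!: derivative_eq_intros)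
        thus "((\<lambda>s. Si (s * w)) has_vector_derivative sinc (s * w) * w) (at s within {u..v})"
          by (simp add: has_real_derivative_iff_has_vector_derivative)
      qed
      \<comment> \<open>Division by zero makes the integrand 0 at \<open>s = 0\<close>, where the
        derivative of \<open>Si (s * w)\<close> is \<open>w\<close>; a single point is
        negligible.\<close>
      thus ?thesis
        by (rule has_integral_spike [OF negligible_sing [of 0], rotated]) (auto simp: field_simps)
    qed
    have "\<bar>Si (v * w) - Si (u * w)\<bar> \<le> 2 * B" for u v
      using B[of "v * w"] B[of "u * w"] by linarith
    thus ?thesis using hi by (intro bdd_partialI[where F = "\<lambda>v. Si (v * w)"]) auto
  qed
  thus ?thesis using that by blast
qed

text \<open>The modulus is at most the Cauchy density \<open>|c| / (c^2 + s^2)\<close>, whose total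
  mass is \<open>pi\<close> however close \<open>c\<close> is to 0.\<close>

lemma bdd_partial_cauchy_cos:
  assumes c: "c \<noteq> 0"
  shows "bdd_partial N pi (\<lambda>s. c / (c\<^sup>2 + s\<^sup>2) * cos (s * w))"
proof -
  have pos: "c\<^sup>2 + s\<^sup>2 > 0" for s using c by (simp add: sum_power2_gt_zero_iff)
  have fi: "(\<lambda>s. c / (c\<^sup>2 + s\<^sup>2) * cos (s * w)) integrable_on {u..v}" for u v
    by (intro integrable_continuous_real continuous_intros) (metis pos less_irrefl)
  have "\<bar>integral {u..v} (\<lambda>s. c / (c\<^sup>2 + s\<^sup>2) * cos (s * w))\<bar> \<le> pi" if "u \<le> v" for u v
  proof -
    have hi: "((\<lambda>s. \<bar>c\<bar> / (c\<^sup>2 + s\<^sup>2)) has_integral (arctan (v / \<bar>c\<bar>) - arctan (u / \<bar>c\<bar>))) {u..v}"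
    proof (rule fundamental_theorem_of_calculus [OF that])
      fix s assume "s \<in> {u..v}"
      have "((\<lambda>s. arctan (s / \<bar>c\<bar>)) has_real_derivative inverse (1 + (s / \<bar>c\<bar>)\<^sup>2) * (1 / \<bar>c\<bar>)) (at s within {u..v})"
        by (rule DERIV_chain2 [OF DERIV_arctan DERIV_cdivide [OF DERIV_ident]])
      also have "inverse (1 + (s / \<bar>c\<bar>)\<^sup>2) * (1 / \<bar>c\<bar>) = \<bar>c\<bar> / (c\<^sup>2 + s\<^sup>2)"
      proof -
        have "inverse (1 + (s / \<bar>c\<bar>)\<^sup>2) = c\<^sup>2 / (c\<^sup>2 + s\<^sup>2)"
          using c by (simp add: power_divide divide_simps)
        moreover have "c\<^sup>2 * (1 / \<bar>c\<bar>) = \<bar>c\<bar>"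
          using c by (simp add: abs_if power2_eq_square)
        ultimately show ?thesis by (metis times_divide_eq_left)
      qed
      finally show "((\<lambda>s. arctan (s / \<bar>c\<bar>)) has_vector_derivative \<bar>c\<bar> / (c\<^sup>2 + s\<^sup>2)) (at s within {u..v})"
        by (simp add: has_real_derivative_iff_has_vector_derivative)
    qed
    have "norm (integral {u..v} (\<lambda>s. c / (c\<^sup>2 + s\<^sup>2) * cos (s * w))) \<le> integral {u..v} (\<lambda>s. \<bar>c\<bar> / (c\<^sup>2 + s\<^sup>2))"
    proof (rule integral_norm_bound_integral [OF fi])
      show "(\<lambda>s. \<bar>c\<bar> / (c\<^sup>2 + s\<^sup>2)) integrable_on {u..v}" using hi by blast
      fix s show "norm (c / (c\<^sup>2 + s\<^sup>2) * cos (s * w)) \<le> \<bar>c\<bar> / (c\<^sup>2 + s\<^sup>2)"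
        using pos[of s] mult_left_mono[OF abs_cos_le_one[of "s * w"], of "\<bar>c\<bar> / (c\<^sup>2 + s\<^sup>2)"]
        by (simp add: abs_mult)
    qed
    also have "\<dots> = arctan (v / \<bar>c\<bar>) - arctan (u / \<bar>c\<bar>)" using hi by blast
    also have "\<dots> \<le> pi" using arctan_bounded[of "v / \<bar>c\<bar>"] arctan_bounded[of "u / \<bar>c\<bar>"] by linarith
    finally show ?thesis by simp
  qed
  with fi show ?thesis unfolding bdd_partial_def by blast
qed

section \<open>Folding an integral onto the half-line\<close>

lemma integral_fold:
  fixes F :: "real \<Rightarrow> complex"
  assumes F: "integrable lborel F"
  shows "integrable lborel (\<lambda>s. indicator {0..} s *\<^sub>R (F s + F (- s)))"
    and "(\<integral>s. F s \<partial>lborel) = (\<integral>s. indicator {0..} s *\<^sub>R (F s + F (- s)) \<partial>lborel)"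
proof -
  have F': "integrable lborel (\<lambda>s. F (- s))"
    using lborel_integrable_real_affine[OF F, of "-1" 0] by simp
  have [measurable]: "F \<in> borel_measurable borel" using F by (simp add: borel_measurable_integrable)
  have i: "integrable lborel (\<lambda>s. indicator A s *\<^sub>R F s)" "integrable lborel (\<lambda>s. indicator A s *\<^sub>R F (- s))"
    if [measurable]: "A \<in> sets borel" for A
    using integrable_mult_indicator[OF _ F, of A] integrable_mult_indicator[OF _ F', of A] that by auto
  show "integrable lborel (\<lambda>s. indicator {0..} s *\<^sub>R (F s + F (- s)))"
    unfolding scaleR_add_right by (intro Bochner_Integration.integrable_add i) auto
  have "(\<integral>s. F s \<partial>lborel) = (\<integral>s. indicator {0..} s *\<^sub>R F s + indicator {..<0} s *\<^sub>R F s \<partial>lborel)"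
    by (intro Bochner_Integration.integral_cong) (auto simp: indicator_def)
  also have "\<dots> = (\<integral>s. indicator {0..} s *\<^sub>R F s \<partial>lborel) + (\<integral>s. indicator {..<0} s *\<^sub>R F s \<partial>lborel)"
    by (intro Bochner_Integration.integral_add i) auto
  also have "(\<integral>s. indicator {..<0} s *\<^sub>R F s \<partial>lborel) = (\<integral>s. indicator {..<0} (- s) *\<^sub>R F (- s) \<partial>lborel)"
    using lborel_integral_real_affine[of "-1" "\<lambda>s. indicator {..<0} s *\<^sub>R F s" 0] by simp
  also have "\<dots> = (\<integral>s. indicator {0..} s *\<^sub>R F (- s) \<partial>lborel)"
    by (intro integral_cong_AE) (use AE_lborel_singleton[of 0] in \<open>auto simp: indicator_def\<close>)
  also have "(\<integral>s. indicator {0..} s *\<^sub>R F s \<partial>lborel) + \<dots> = (\<integral>s. indicator {0..} s *\<^sub>R (F s + F (- s)) \<partial>lborel)"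
    unfolding scaleR_add_right by (intro Bochner_Integration.integral_add[symmetric] i) auto
  finally show "(\<integral>s. F s \<partial>lborel) = (\<integral>s. indicator {0..} s *\<^sub>R (F s + F (- s)) \<partial>lborel)" .
qed

text \<open>The integral is the limit of partial integrals of its folded real integrand, so it
  inherits their bound. The size of the absolute integral of \<open>F\<close> does not enter, which
  allows bounds uniform in the pole.\<close>

lemma norm_integral_fold_le:
  fixes F :: "real \<Rightarrow> complex"
  assumes F: "integrable lborel F"
    and g: "\<And>s. s \<ge> 0 \<Longrightarrow> F s + F (- s) = of_real (g s)"
    and M: "\<And>N. N \<ge> 0 \<Longrightarrow> bdd_partial N M g"
  shows "norm (\<integral>s. F s \<partial>lborel) \<le> M"
proof -
  let ?h = "\<lambda>s. indicator {0..} s *\<^sub>R g s"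
  have eq: "indicator {0..} s *\<^sub>R (F s + F (- s)) = of_real (?h s)" for s
    by (cases "s \<ge> 0") (auto simp: g)
  have i: "integrable lborel ?h"
    using integral_fold(1)[OF F] unfolding eq complex_of_real_integrable_eq .
  have "((\<lambda>N. integral {0..N} g) \<longlongrightarrow> (\<integral>s. ?h s \<partial>lborel)) at_top"
    by (rule tendsto_integral_Icc_at_top[OF i])
  moreover have "eventually (\<lambda>N. \<bar>integral {0..N} g\<bar> \<le> M) at_top"
    using eventually_ge_at_top[of 0] by eventually_elim (use M in \<open>auto simp: bdd_partial_def\<close>)
  ultimately have "\<bar>\<integral>s. ?h s \<partial>lborel\<bar> \<le> M"
    by (intro tendsto_upperbound[OF tendsto_rabs]) auto
  thus ?thesis
    unfolding integral_fold(2)[OF F] eq integral_complex_of_real by simp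
qed

section \<open>The oscillatory kernels without and with a pole\<close>

definition kern0 :: "real \<Rightarrow> real \<Rightarrow> real \<Rightarrow> complex" where
  "kern0 y L w = (\<integral>s. of_real (env y L s) * cis (s * w) \<partial>lborel)"

text \<open>With \<open>c = Re l - k\<close>, the denominator \<open>c + i s\<close> is the distance
  of the point \<open>Re l + i s\<close> of the integration path from the pole \<open>k\<close>,
  taken as a complex difference.\<close>

definition kern :: "real \<Rightarrow> real \<Rightarrow> real \<Rightarrow> real \<Rightarrow> complex" where
  "kern y L c w = (\<integral>s. of_real (env y L s) * cis (s * w) / Complex c s \<partial>lborel)"

lemma borel_measurable_cis [measurable]: "cis \<in> borel_measurable borel"
  by (intro borel_measurable_continuous_onI continuous_intros)

lemma borel_measurable_Complex [measurable (raw)]: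
  assumes "f \<in> borel_measurable M" "g \<in> borel_measurable M"
  shows "(\<lambda>x. Complex (f x) (g x)) \<in> borel_measurable M"
  unfolding Complex_eq using assms by measurable

lemma kern0_integrable:
  assumes "L \<ge> 0" "y \<noteq> 0"
  shows "integrable lborel (\<lambda>s. complex_of_real (env y L s) * cis (s * w))"
  by (rule Bochner_Integration.integrable_bound[OF env_integrable(1)[OF assms]])
     (auto simp: norm_mult)

lemma kern_integrable:
  assumes "L \<ge> 0" "y \<noteq> 0" "c \<noteq> 0"
  shows "integrable lborel (\<lambda>s. complex_of_real (env y L s) * cis (s * w) / Complex c s)"
proof (rule Bochner_Integration.integrable_bound)
  show "integrable lborel (\<lambda>s. env y L s / \<bar>c\<bar>)"
    using env_integrable(1)[OF assms(1,2)] by simp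
  show "AE s in lborel. norm (complex_of_real (env y L s) * cis (s * w) / Complex c s) \<le> norm (env y L s / \<bar>c\<bar>)"
  proof (rule AE_I2)
    fix s
    have "\<bar>c\<bar> \<le> cmod (Complex c s)" using abs_Re_le_cmod[of "Complex c s"] by simp
    then show "norm (complex_of_real (env y L s) * cis (s * w) / Complex c s) \<le> norm (env y L s / \<bar>c\<bar>)"
      using assms(3) by (auto simp: norm_mult norm_divide intro!: divide_left_mono mult_pos_pos)
  qed
qed measurable

text \<open>Since \<open>1 / (c + i s) = (c - i s) / (c^2 + s^2)\<close> and the envelope is even,
  the odd parts cancel and what remains is real.\<close>

lemma kern_fold:
  assumes "c \<noteq> 0"
  shows "complex_of_real (env y L s) * cis (s * w) / Complex c s
       + complex_of_real (env y L (- s)) * cis (- s * w) / Complex c (- s)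
     = of_real (2 * (env y L s * (c / (c\<^sup>2 + s\<^sup>2) * cos (s * w)) + env y L s * (s / (c\<^sup>2 + s\<^sup>2) * sin (s * w))))"
proof -
  have "c\<^sup>2 + s\<^sup>2 \<noteq> 0" using assms by (simp add: sum_power2_eq_zero_iff)
  then show ?thesis
    by (simp add: complex_eq_iff Re_divide Im_divide divide_simps) (simp add: algebra_simps power2_eq_square)
qed

lemma norm_kern0_le_sqrt:
  assumes "L \<ge> 0" "y \<noteq> 0"
  shows "norm (kern0 y L w) \<le> 2 * sqrt (pi / \<bar>y\<bar>)"
proof -
  have "norm (kern0 y L w) \<le> (\<integral>s. norm (complex_of_real (env y L s) * cis (s * w)) \<partial>lborel)"
    unfolding kern0_def by (rule integral_norm_bound)
  also have "\<dots> = (\<integral>s. env y L s \<partial>lborel)"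
    by (simp add: norm_mult env_nonneg)
  finally show ?thesis using env_integrable(2)[OF assms] by linarith
qed

lemma norm_kern0_le_inverse:
  assumes "L \<ge> 0" "y \<noteq> 0" "w \<noteq> 0"
  shows "norm (kern0 y L w) \<le> 8 / \<bar>w\<bar>"
  unfolding kern0_def
proof (rule norm_integral_fold_le[OF kern0_integrable[OF assms(1,2)]])
  fix s :: real
  show "complex_of_real (env y L s) * cis (s * w) + complex_of_real (env y L (- s)) * cis (- s * w)
     = of_real (2 * (env y L s * cos (s * w)))"
    by (simp add: complex_eq_iff)
  fix N :: real assume N: "N \<ge> 0"
  \<comment> \<open>The constant is \<open>2 / |w|\<close> from the cosine, doubled by the envelope
    and doubled again by folding.\<close>
  have "bdd_partial N (\<bar>2\<bar> * (2 * (2 / \<bar>w\<bar>))) (\<lambda>s. 2 * (env y L s * cos (s * w)))"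
    by (intro bdd_partial_cmult bdd_partial_env bdd_partial_cos assms N)
  thus "bdd_partial N (8 / \<bar>w\<bar>) (\<lambda>s. 2 * (env y L s * cos (s * w)))"
    by simp
qed

text \<open>
  The odd kernel \<open>s / (c\<^sup>2 + s\<^sup>2) \<cdot> sin (s w)\<close> is not absolutely integrable uniformly in \<open>c\<close>; it is
  written as the increasing function \<open>s\<^sup>2 / (c\<^sup>2 + s\<^sup>2)\<close> times \<open>sin (s w) / s\<close>.
\<close>

lemma kern_bounded:
  obtains C where "\<And>y L c w. L \<ge> 0 \<Longrightarrow> y \<noteq> 0 \<Longrightarrow> c \<noteq> 0 \<Longrightarrow> norm (kern y L c w) \<le> C"
proof -
  obtain M where M: "\<And>N w. bdd_partial N M (\<lambda>s. sin (s * w) / s)" using bdd_partial_sinc by blast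
  have "norm (kern y L c w) \<le> \<bar>2\<bar> * (2 * pi + 2 * M)" if a: "L \<ge> 0" "y \<noteq> 0" "c \<noteq> 0" for y L c w
    unfolding kern_def
  proof (rule norm_integral_fold_le[OF kern_integrable[OF a] kern_fold[OF a(3)]])
    fix N :: real assume N: "N \<ge> 0"
    have "bdd_partial N M (\<lambda>s. s\<^sup>2 / (c\<^sup>2 + s\<^sup>2) * (sin (s * w) / s))"
    proof (rule bdd_partial_mono[OF M N])
      fix s t :: real assume st: "0 \<le> s" "s \<le> t"
      have p: "c\<^sup>2 + s\<^sup>2 > 0" "c\<^sup>2 + t\<^sup>2 > 0" using a by (auto simp: sum_power2_gt_zero_iff)
      have "c\<^sup>2 * s\<^sup>2 \<le> c\<^sup>2 * t\<^sup>2" using st by (intro mult_left_mono power_mono) auto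
      with p show "s\<^sup>2 / (c\<^sup>2 + s\<^sup>2) \<le> t\<^sup>2 / (c\<^sup>2 + t\<^sup>2)" by (simp add: divide_simps algebra_simps)
    next
      fix s :: real
      have p: "c\<^sup>2 + s\<^sup>2 > 0" using a by (auto simp: sum_power2_gt_zero_iff)
      show "0 \<le> s\<^sup>2 / (c\<^sup>2 + s\<^sup>2) \<and> s\<^sup>2 / (c\<^sup>2 + s\<^sup>2) \<le> 1" using p by (simp add: divide_simps)
    qed
    also have "(\<lambda>s. s\<^sup>2 / (c\<^sup>2 + s\<^sup>2) * (sin (s * w) / s)) = (\<lambda>s. s / (c\<^sup>2 + s\<^sup>2) * sin (s * w))"
      by (auto simp: power2_eq_square)
    finally show "bdd_partial N (\<bar>2\<bar> * (2 * pi + 2 * M))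
       (\<lambda>s. 2 * (env y L s * (c / (c\<^sup>2 + s\<^sup>2) * cos (s * w)) + env y L s * (s / (c\<^sup>2 + s\<^sup>2) * sin (s * w))))"
      by (intro bdd_partial_cmult bdd_partial_add bdd_partial_env bdd_partial_cauchy_cos N a)
  qed
  thus ?thesis using that by blast
qed

text \<open>For \<open>y > 0\<close> the path keeps a distance of at least
  \<open>m = sqrt (c^2 + L^2)\<close> from the pole. Each rational factor is written through
  monotone multipliers in \<open>[0,1]\<close> and a power of \<open>1 / m\<close>, so the decay
  \<open>1 / |w|\<close> of sine and cosine survives.\<close>

lemma norm_kern_le_inverse:
  assumes a: "L \<ge> 0" "y > 0" "c \<noteq> 0" and w: "w \<noteq> 0"
  shows "norm (kern y L c w) \<le> 48 / (sqrt (c\<^sup>2 + L\<^sup>2) * \<bar>w\<bar>)"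
proof -
  define m where "m = sqrt (c\<^sup>2 + L\<^sup>2)"
  have m: "m > 0" "m\<^sup>2 = c\<^sup>2 + L\<^sup>2" "\<bar>c\<bar> \<le> m"
    using a by (auto simp: m_def sum_power2_gt_zero_iff)
  \<comment> \<open>\<open>env\<close> vanishes for \<open>s \<le> L\<close>, so \<open>q s\<close> may replace \<open>\<bar>c + i s\<bar>\<close>; unlike it, \<open>q s\<close> is bounded below by \<open>m\<close>.\<close>
  define q where "q s = sqrt (c\<^sup>2 + (max s L)\<^sup>2)" for s
  have q: "q s \<ge> m" for s
    using a by (auto simp: q_def m_def intro!: power_mono)
  hence qpos: "q s > 0" for s using m(1) by (meson order_less_le_trans)
  have q_mono: "q s \<le> q t" if "s \<le> t" for s t
    using that a by (auto simp: q_def intro!: power_mono)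
  have d1: "m / q t \<le> m / q s" if "s \<le> t" for s t
    using q_mono[OF that] qpos m by (intro divide_left_mono) auto
  have d2: "0 \<le> m / q s \<and> m / q s \<le> 1" for s
    using q[of s] m qpos[of s] by (auto simp: divide_simps)
  have "norm (kern y L c w) \<le> \<bar>2\<bar> * (\<bar>c / m\<^sup>2\<bar> * (2 * (2 * (2 * (2 / \<bar>w\<bar>)))) + \<bar>1 / m\<bar> * (2 * (2 * (2 / \<bar>w\<bar>))))"
    unfolding kern_def
  proof (rule norm_integral_fold_le[OF kern_integrable[OF a(1) _ a(3)]])
    fix s :: real assume s: "s \<ge> 0"
    have eq: "q s = sqrt (c\<^sup>2 + s\<^sup>2)" if "env y L s \<noteq> 0"
    proof -
      have "(s\<^sup>2 - L\<^sup>2) * y > 0" using that by (auto simp: env_def heaviside_def split: if_splits)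
      hence "s > L" using a s by (auto simp: zero_less_mult_iff intro: power2_less_imp_less)
      thus ?thesis by (simp add: q_def max_def)
    qed
    have "c\<^sup>2 + s\<^sup>2 > 0" using a by (simp add: sum_power2_gt_zero_iff)
    \<comment> \<open>The cosine term takes two decreasing multipliers \<open>m / q s\<close>; the
      sine term takes one, together with the increasing \<open>s / sqrt (c^2 + s^2)\<close>.\<close>
    hence "env y L s * (c / (c\<^sup>2 + s\<^sup>2) * cos (s * w))
        = c / m\<^sup>2 * (env y L s * (m / q s * (m / q s * cos (s * w))))"
      using eq m(1) by (cases "env y L s = 0") (auto simp: power2_eq_square[of m])
    moreover have "env y L s * (s / (c\<^sup>2 + s\<^sup>2) * sin (s * w))
        = 1 / m * (env y L s * (m / q s * (s / sqrt (c\<^sup>2 + s\<^sup>2) * sin (s * w))))"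
      using eq m(1) \<open>c\<^sup>2 + s\<^sup>2 > 0\<close> by (cases "env y L s = 0") auto
    ultimately
    show "complex_of_real (env y L s) * cis (s * w) / Complex c s
       + complex_of_real (env y L (- s)) * cis (- s * w) / Complex c (- s)
     = of_real (2 * (c / m\<^sup>2 * (env y L s * (m / q s * (m / q s * cos (s * w))))
         + 1 / m * (env y L s * (m / q s * (s / sqrt (c\<^sup>2 + s\<^sup>2) * sin (s * w))))))"
      unfolding kern_fold[OF a(3)] by (simp only:)
  next
    fix N :: real assume N: "N \<ge> 0"
    have "bdd_partial N (2 / \<bar>w\<bar>) (\<lambda>s. s / sqrt (c\<^sup>2 + s\<^sup>2) * sin (s * w))"
    proof (rule bdd_partial_mono[OF bdd_partial_sin[OF w] N])
      fix s t :: real assume st: "0 \<le> s" "s \<le> t"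
      have p: "c\<^sup>2 + s\<^sup>2 > 0" "c\<^sup>2 + t\<^sup>2 > 0" using a by (auto simp: sum_power2_gt_zero_iff)
      have "c\<^sup>2 * s\<^sup>2 \<le> c\<^sup>2 * t\<^sup>2" using st by (intro mult_left_mono power_mono) auto
      with p have "s\<^sup>2 / (c\<^sup>2 + s\<^sup>2) \<le> t\<^sup>2 / (c\<^sup>2 + t\<^sup>2)" by (simp add: divide_simps algebra_simps)
      hence "sqrt (s\<^sup>2 / (c\<^sup>2 + s\<^sup>2)) \<le> sqrt (t\<^sup>2 / (c\<^sup>2 + t\<^sup>2))" by simp
      with st show "s / sqrt (c\<^sup>2 + s\<^sup>2) \<le> t / sqrt (c\<^sup>2 + t\<^sup>2)" by (simp add: real_sqrt_divide)
    next
      fix s :: real assume "0 \<le> s"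
      have p: "sqrt (c\<^sup>2 + s\<^sup>2) > 0" using a by (auto simp: sum_power2_gt_zero_iff)
      moreover have "s \<le> sqrt (c\<^sup>2 + s\<^sup>2)" by (rule real_le_rsqrt) simp
      ultimately show "0 \<le> s / sqrt (c\<^sup>2 + s\<^sup>2) \<and> s / sqrt (c\<^sup>2 + s\<^sup>2) \<le> 1"
        using \<open>0 \<le> s\<close> by (simp add: divide_simps)
    qed
    then show "bdd_partial N (\<bar>2\<bar> * (\<bar>c / m\<^sup>2\<bar> * (2 * (2 * (2 * (2 / \<bar>w\<bar>)))) + \<bar>1 / m\<bar> * (2 * (2 * (2 / \<bar>w\<bar>)))))
        (\<lambda>s. 2 * (c / m\<^sup>2 * (env y L s * (m / q s * (m / q s * cos (s * w))))
         + 1 / m * (env y L s * (m / q s * (s / sqrt (c\<^sup>2 + s\<^sup>2) * sin (s * w))))))"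
      by (intro bdd_partial_cmult bdd_partial_add bdd_partial_env bdd_partial_antimono
          bdd_partial_cos N a w d1 d2) 
  qed (use a in auto)
  \<comment> \<open>The estimate \<open>|c| \<le> m\<close> reduces both prefactors to
    \<open>1 / m\<close>, and 48 is \<open>2 * (16 + 8)\<close>.\<close>
  also have "\<dots> \<le> 2 * (1 / m * (16 / \<bar>w\<bar>) + 1 / m * (8 / \<bar>w\<bar>))"
  proof -
    have "\<bar>c / m\<^sup>2\<bar> \<le> m / m\<^sup>2" using m(3) by (simp add: divide_right_mono)
    also have "\<dots> = 1 / m" by (simp add: power2_eq_square)
    finally have "\<bar>c / m\<^sup>2\<bar> \<le> 1 / m" .
    from mult_right_mono[OF this, of "16 / \<bar>w\<bar>"] show ?thesis using m(1) by simp
  qed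
  also have "\<dots> = 48 / (m * \<bar>w\<bar>)" by (simp add: field_simps)
  finally show ?thesis unfolding m_def .
qed

text \<open>On the support of the envelope \<open>|s| > L\<close>, so the denominator has modulus at
  least \<open>sqrt (c^2 + L^2)\<close>, and the integral of the envelope supplies the rest.\<close>

lemma norm_kern_le_sqrt:
  assumes a: "L \<ge> 0" "y > 0" "c \<noteq> 0"
  shows "norm (kern y L c w) \<le> 2 * sqrt (pi / y) / sqrt (c\<^sup>2 + L\<^sup>2)"
proof -
  have pos: "sqrt (c\<^sup>2 + L\<^sup>2) > 0" using a by (simp add: sum_power2_gt_zero_iff)
  have b: "norm (complex_of_real (env y L s) * cis (s * w) / Complex c s) \<le> env y L s / sqrt (c\<^sup>2 + L\<^sup>2)" for s
  proof (cases "env y L s = 0")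
    case False
    hence "(s\<^sup>2 - L\<^sup>2) * y > 0" by (auto simp: env_def heaviside_def split: if_splits)
    hence "s\<^sup>2 > L\<^sup>2" using a by (auto simp: zero_less_mult_iff)
    hence "sqrt (c\<^sup>2 + L\<^sup>2) \<le> norm (Complex c s)" by (simp add: complex_norm)
    thus ?thesis using pos env_nonneg[of y L s]
      by (auto simp: norm_mult norm_divide intro!: divide_left_mono mult_pos_pos)
  qed auto
  have "norm (kern y L c w) \<le> (\<integral>s. env y L s / sqrt (c\<^sup>2 + L\<^sup>2) \<partial>lborel)"
    unfolding kern_def using b env_integrable(1)[of L y] a
    by (intro order_trans[OF integral_norm_bound] Bochner_Integration.integral_mono
        integrable_norm kern_integrable) auto
  also have "\<dots> = (\<integral>s. env y L s \<partial>lborel) / sqrt (c\<^sup>2 + L\<^sup>2)" by simp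
  also have "\<dots> \<le> 2 * sqrt (pi / y) / sqrt (c\<^sup>2 + L\<^sup>2)"
    using env_integrable(2)[of L y] a pos by (intro divide_right_mono) auto
  finally show ?thesis .
qed

section \<open>Rotating the path of integration\<close>

text \<open>The substitution \<open>s -> -s\<close> reduces \<open>w < 0\<close> to
  \<open>w > 0\<close>, where \<open>exp (- (t * w))\<close> decays along the rotated
  half-lines.\<close>

lemma kern_reflect: "kern y L (- c) (- w) = - kern y L c w"
proof -
  have C: "Complex (- c) (- s) = - Complex c s" for s by (simp add: complex_eq_iff)
  have "kern y L (- c) (- w)
      = (\<integral>s. of_real (env y L (- s)) * cis (- s * - w) / Complex (- c) (- s) \<partial>lborel)"
    using lborel_integral_real_affine[of "-1" "\<lambda>s. of_real (env y L s) * cis (s * - w) / Complex (- c) s" 0]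
    unfolding kern_def by simp
  also have "\<dots> = - kern y L c w"
    unfolding kern_def C by simp
  finally show ?thesis .
qed

text \<open>
  The contributions of the vertical half-lines \<open>L + i t\<close> and \<open>- L + i t\<close> are complex conjugates of each
  other; this is their real part.
\<close>

definition side :: "real \<Rightarrow> real \<Rightarrow> real \<Rightarrow> real \<Rightarrow> real \<Rightarrow> real" where
  "side b L c w t = exp (- (t * w + t\<^sup>2 * b)) * Re (cis (L * w + 2 * L * t * b) / Complex L (t - c))"

section \<open>Integrals over the vertical half-lines\<close>

lemma borel_measurable_side [measurable]: "side b L c w \<in> borel_measurable borel"
  unfolding side_def by measurable

text \<open>The denominator has real part \<open>L\<close>, so its modulus is at least
  \<open>L\<close> for every position \<open>c\<close> of the pole.\<close>

lemma abs_side_le: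
  assumes "L > 0"
  shows "\<bar>side b L c w t\<bar> \<le> exp (- (t * w + t\<^sup>2 * b)) / L"
proof -
  have "L \<le> cmod (Complex L (t - c))" using abs_Re_le_cmod[of "Complex L (t - c)"] assms by simp
  hence "cmod (cis (L * w + 2 * L * t * b) / Complex L (t - c)) \<le> 1 / L"
    using assms by (auto simp: norm_divide intro!: divide_left_mono mult_pos_pos)
  hence "\<bar>Re (cis (L * w + 2 * L * t * b) / Complex L (t - c))\<bar> \<le> 1 / L"
    using abs_Re_le_cmod order_trans by blast
  thus ?thesis
    using mult_left_mono[of "\<bar>Re (cis (L * w + 2 * L * t * b) / Complex L (t - c))\<bar>" "1 / L" "exp (- (t * w + t\<^sup>2 * b))"]
    by (simp add: side_def abs_mult)
qed

lemma exp_quad_integrable: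
  fixes b w :: real assumes "b > 0"
  shows "integrable lborel (\<lambda>t. exp (- (t * w + t\<^sup>2 * b)))"
proof -
  have eq: "- (t * w + t\<^sup>2 * b) = w\<^sup>2 / (4 * b) + - (b * (t - (- w / (2 * b)))\<^sup>2)" for t
    using assms by (simp add: field_simps power2_eq_square)
  show ?thesis
    unfolding eq exp_add using gauss_integrable(1)[OF assms] by (rule integrable_mult_right)
qed

lemma side_integrable:
  assumes "L > 0" "b > 0"
  shows "integrable lborel (\<lambda>t. indicator {0..} t *\<^sub>R side b L c w t)"
proof (rule Bochner_Integration.integrable_bound)
  show "integrable lborel (\<lambda>t. exp (- (t * w + t\<^sup>2 * b)) / L)"
    using exp_quad_integrable[OF assms(2)] by simp
  show "AE t in lborel. norm (indicator {0..} t *\<^sub>R side b L c w t) \<le> norm (exp (- (t * w + t\<^sup>2 * b)) / L)"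
    using abs_side_le[OF assms(1), of b c w] assms by (intro AE_I2) (auto simp: indicator_def)
qed measurable

text \<open>For \<open>w \<ge> 0\<close> and \<open>t \<ge> 0\<close> the factor
  \<open>exp (- (t * w))\<close> is at most 1, which leaves a Gaussian.\<close>

lemma side_integral_le_sqrt:
  assumes "L > 0" "b > 0" "w \<ge> 0"
  shows "\<bar>\<integral>t. indicator {0..} t *\<^sub>R side b L c w t \<partial>lborel\<bar> \<le> sqrt (pi / b) / L"
proof -
  have g: "integrable lborel (\<lambda>t. exp (- (b * (t - 0)\<^sup>2)) / L)"
    using gauss_integrable(1)[OF assms(2), of 0] by simp
  have "\<bar>\<integral>t. indicator {0..} t *\<^sub>R side b L c w t \<partial>lborel\<bar>
      \<le> (\<integral>t. norm (indicator {0..} t *\<^sub>R side b L c w t) \<partial>lborel)"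
    using integral_norm_bound[of lborel "\<lambda>t. indicator {0..} t *\<^sub>R side b L c w t"] by simp
  also have "\<dots> \<le> (\<integral>t. exp (- (b * (t - 0)\<^sup>2)) / L \<partial>lborel)"
  proof (rule Bochner_Integration.integral_mono)
    show "integrable lborel (\<lambda>t. norm (indicator {0..} t *\<^sub>R side b L c w t))"
      using side_integrable[OF assms(1,2)] by (rule integrable_norm)
    fix t :: real
    have "exp (- (t * w + t\<^sup>2 * b)) / L \<le> exp (- (b * (t - 0)\<^sup>2)) / L" if "t \<ge> 0"
      using that assms by (intro divide_right_mono) (auto simp: mult.commute)
    thus "norm (indicator {0..} t *\<^sub>R side b L c w t) \<le> exp (- (b * (t - 0)\<^sup>2)) / L"
      using abs_side_le[OF assms(1), of b c w t] assms by (auto simp: indicator_def)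
  qed (rule g)
  also have "\<dots> = sqrt (pi / b) / L"
    using gauss_integrable(2)[OF assms(2), of 0] by simp
  finally show ?thesis .
qed

text \<open>Here the Gaussian factor is bounded by 1 instead, and the integral of
  \<open>exp (- (t * w))\<close> over the half-line is \<open>1 / w\<close>.\<close>

lemma side_integral_le_inverse:
  assumes "L > 0" "b > 0" "w > 0"
  shows "\<bar>\<integral>t. indicator {0..} t *\<^sub>R side b L c w t \<partial>lborel\<bar> \<le> 1 / (w * L)"
proof -
  have "\<bar>integral {0..N} (side b L c w)\<bar> \<le> 1 / (w * L)" if N: "N \<ge> 0" for N
  proof -
    have hi: "((\<lambda>t. exp (- (t * w)) / L) has_integral (- (exp (- (N * w)) / (w * L)) - - (exp (- (0 * w)) / (w * L)))) {0..N}"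
      by (rule fundamental_theorem_of_calculus [OF N])
         (use assms in \<open>auto intro!: derivative_eq_intros simp flip: has_real_derivative_iff_has_vector_derivative\<close>)
    have "set_integrable lborel {0..N} (side b L c w)"
      unfolding set_integrable_def
      by (rule Bochner_Integration.integrable_bound[OF side_integrable[OF assms(1,2), of c w]])
         (auto simp: indicator_def)
    hence si: "side b L c w integrable_on {0..N}" by (rule set_borel_integral_eq_integral(1))
    have "norm (integral {0..N} (side b L c w)) \<le> integral {0..N} (\<lambda>t. exp (- (t * w)) / L)"
    proof (rule integral_norm_bound_integral [OF si])
      fix t assume t: "t \<in> {0..N}"
      have "exp (- (t * w + t\<^sup>2 * b)) / L \<le> exp (- (t * w)) / L"
        using t assms by (intro divide_right_mono) auto
      thus "norm (side b L c w t) \<le> exp (- (t * w)) / L"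
        using abs_side_le[OF assms(1), of b c w t] by simp
    qed (use hi in blast)
    also have "\<dots> = 1 / (w * L) - exp (- (N * w)) / (w * L)"
      using integral_unique[OF hi] by simp
    also have "\<dots> \<le> 1 / (w * L)" using assms by simp
    finally show ?thesis by simp
  qed
  hence "eventually (\<lambda>N. \<bar>integral {0..N} (side b L c w)\<bar> \<le> 1 / (w * L)) at_top"
    using eventually_ge_at_top[of 0] by (rule eventually_mono[rotated])
  with tendsto_integral_Icc_at_top[OF side_integrable[OF assms(1,2)], of c w] show ?thesis
    by (intro tendsto_upperbound[OF tendsto_rabs]) auto
qed

section \<open>Contour rotation for \<open>y < 0\<close>\<close>

lemma kern_eq_integral:
  assumes y: "y < 0" and L: "L > 0" and c: "c \<noteq> 0"
  shows "kern y L c w = integral {-L..L} (\<lambda>s. exp (- ((s\<^sup>2 - L\<^sup>2) * y)) *\<^sub>R (cis (s * w) / Complex c s))"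
proof -
  let ?f = "\<lambda>s. exp (- ((s\<^sup>2 - L\<^sup>2) * y)) *\<^sub>R (cis (s * w) / Complex c s)"
  have "Complex c s \<noteq> 0" for s using c by (simp add: complex_eq_iff)
  hence "continuous_on {-L..L} ?f"
    unfolding Complex_eq by (intro continuous_intros) auto
  hence si: "set_integrable lborel {-L..L} ?f" by (rule borel_integrable_atLeastAtMost')
  have "kern y L c w = (\<integral>s. indicator {-L..L} s *\<^sub>R ?f s \<partial>lborel)"
    unfolding kern_def
  proof (rule integral_cong_AE)
    \<comment> \<open>For \<open>y < 0\<close> the cut-off keeps the open segment
      \<open>|s| < L\<close>; the closed one adds two points of measure zero.\<close>
    show "AE s in lborel. complex_of_real (env y L s) * cis (s * w) / Complex c s = indicator {-L..L} s *\<^sub>R ?f s"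
      using AE_lborel_singleton[of L] AE_lborel_singleton[of "-L"]
    proof eventually_elim
      case (elim s)
      have "(s\<^sup>2 - L\<^sup>2) * y > 0 \<longleftrightarrow> s\<^sup>2 < L\<^sup>2"
        using y by (simp add: zero_less_mult_iff)
      also have "\<dots> \<longleftrightarrow> \<bar>s\<bar> < L"
        using L abs_le_square_iff[of L s] by (auto simp: not_le[symmetric])
      finally show ?case using elim L
        by (auto simp: env_def heaviside_def indicator_def scaleR_conv_of_real)
    qed
  qed measurable
  also have "\<dots> = integral {-L..L} ?f"
    using set_borel_integral_eq_integral(2)[OF si] unfolding set_lebesgue_integral_def .
  finally show ?thesis .
qed

text \<open>Cauchy's integral formula is applied on the rectangle over \<open>[-L, L]\<close> of
  height \<open>H\<close>, and \<open>H\<close> tends to infinity. The bottom side gives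
  \<open>kern\<close>, the vertical sides give \<open>side\<close>, the top side vanishes, and the
  pole contributes its residue exactly when \<open>c > 0\<close>.\<close>

lemma kern_rotate:
  assumes y: "y < 0" and L: "L > 0" and c: "c \<noteq> 0"
  shows "kern y L c w = of_real (2 * pi * heaviside c * exp (- (c * w) + (c\<^sup>2 + L\<^sup>2) * y)
           - 2 * (\<integral>t. indicator {0..} t *\<^sub>R side (- y) L c w t \<partial>lborel))"
proof -
  define b where "b = - y"
  have b: "b > 0" using y by (simp add: b_def)
  \<comment> \<open>Since \<open>c + i s = i (s - p)\<close>, the integrand on the segment is
    \<open>h s / (i (s - p))\<close> with the entire function \<open>h\<close> defined next.\<close>
  define p where "p = \<i> * of_real c"
  define h where "h z = exp (\<i> * z * of_real w + (z\<^sup>2 - of_real (L\<^sup>2)) * of_real b)" for z :: complex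
  define R where "R = 2 * of_real pi * \<i> * of_real (heaviside c) * h p"
  have hp: "h p = of_real (exp (- (c * w) + (c\<^sup>2 + L\<^sup>2) * y))"
    unfolding h_def p_def b_def exp_of_real[symmetric]
    by (rule arg_cong[of _ _ exp]) (simp add: algebra_simps power_mult_distrib)
  define top where "top H = contour_integral (linepath (Complex L H) (Complex (- L) H)) (\<lambda>z. h z / (z - p))" for H
  have main: "\<i> * kern y L c w + 2 * \<i> * of_real (integral {0..H} (side b L c w)) + top H = R"
    if H: "H > 0" "H > c" for H
  proof -
    define rc where "rc = rectpath (Complex (- L) 0) (Complex L H)"
    have notp: "p \<notin> path_image rc"
      unfolding rc_def using L H c by (subst path_image_rectpath) (auto simp: p_def)
    have "((\<lambda>z. h z / (z - p)) has_contour_integral (2 * pi * \<i> * winding_number rc p * h p)) rc"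
    proof (rule Cauchy_integral_formula_convex_simple[of UNIV])
      show "h holomorphic_on UNIV" unfolding h_def by (intro holomorphic_intros)
    qed (use notp in \<open>auto simp: rc_def\<close>)
    \<comment> \<open>The point \<open>p = i c\<close> lies inside the rectangle for
      \<open>c > 0\<close>, because \<open>H > c\<close>, and below it for
      \<open>c < 0\<close>.\<close>
    moreover have "winding_number rc p = of_real (heaviside c)"
    proof (cases "c > 0")
      case True
      hence "winding_number rc p = 1" unfolding rc_def
        by (intro winding_number_rectpath) (use L H in \<open>auto simp: p_def in_box_complex_iff\<close>)
      thus ?thesis using True by (simp add: heaviside_def)
    next
      case False
      hence "winding_number rc p = 0" unfolding rc_def
        by (intro winding_number_rectpath_outside) (use L H c in \<open>auto simp: p_def in_cbox_complex_iff\<close>)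
      thus ?thesis using False by (simp add: heaviside_def)
    qed
    ultimately have ci: "contour_integral rc (\<lambda>z. h z / (z - p)) = R"
      unfolding R_def using contour_integral_unique by fastforce
    have cont: "continuous_on S (\<lambda>z. h z / (z - p))" if "p \<notin> S" for S
      unfolding h_def using that by (intro continuous_intros) auto
    have seg: "(\<lambda>z. h z / (z - p)) contour_integrable_on (linepath u v)" if "p \<notin> closed_segment u v" for u v
      by (rule contour_integrable_continuous_linepath[OF cont[OF that]])
    define a1 a2 a3 a4 where "a1 = Complex (- L) 0" "a2 = Complex L 0" "a3 = Complex L H" "a4 = Complex (- L) H"
    note a_def = this
    have rc: "rc = linepath a1 a2 +++ linepath a2 a3 +++ linepath a3 a4 +++ linepath a4 a1"
      by (simp add: rc_def rectpath_def a_def Let_def)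
    have np: "p \<notin> closed_segment a1 a2" "p \<notin> closed_segment a2 a3" "p \<notin> closed_segment a3 a4" "p \<notin> closed_segment a4 a1"
      using notp unfolding rc by (auto simp: path_image_join)
    have sum: "contour_integral (linepath a1 a2) (\<lambda>z. h z / (z - p)) + (contour_integral (linepath a2 a3) (\<lambda>z. h z / (z - p))
       + (contour_integral (linepath a3 a4) (\<lambda>z. h z / (z - p)) + contour_integral (linepath a4 a1) (\<lambda>z. h z / (z - p)))) = R"
      unfolding ci[symmetric] rc using np
      by (simp add: contour_integral_join contour_integrable_joinI seg)
    have 1: "contour_integral (linepath a1 a2) (\<lambda>z. h z / (z - p)) = \<i> * kern y L c w"
    proof -
      have ne: "Complex c s \<noteq> 0" "of_real s - p \<noteq> 0" for s
        using c by (auto simp: complex_eq_iff p_def)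
      have eq: "h (of_real s) / (of_real s - p) = \<i> * (exp (- ((s\<^sup>2 - L\<^sup>2) * y)) *\<^sub>R (cis (s * w) / Complex c s))" for s
      proof -
        have "h (of_real s) = exp (- ((s\<^sup>2 - L\<^sup>2) * y)) *\<^sub>R cis (s * w)"
          unfolding h_def cis_conv_exp scaleR_conv_of_real exp_of_real[symmetric] exp_add[symmetric] b_def
          by (rule arg_cong[of _ _ exp]) (simp add: algebra_simps)
        moreover have "Complex c s = \<i> * (of_real s - p)" by (simp add: complex_eq_iff p_def)
        ultimately show ?thesis using ne[of s] by (simp add: divide_simps)
      qed
      have "contour_integral (linepath a1 a2) (\<lambda>z. h z / (z - p)) = integral {Re a1..Re a2} (\<lambda>x. h (of_real x) / (of_real x - p))"
        by (rule contour_integral_linepath_Reals_eq) (use L in \<open>auto simp: a_def complex_is_Real_iff\<close>)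
      also have "\<dots> = \<i> * kern y L c w"
        unfolding eq kern_eq_integral[OF y L c] Henstock_Kurzweil_Integration.integral_mult_right by (simp add: a_def)
      finally show ?thesis .
    qed
    have hside: "h (Complex r t) = exp (- (t * w + t\<^sup>2 * b)) *\<^sub>R cis (r * w + 2 * r * t * b)" if "r\<^sup>2 = L\<^sup>2" for r t
    proof -
      have "\<i> * Complex r t * of_real w + ((Complex r t)\<^sup>2 - of_real (L\<^sup>2)) * of_real b
          = of_real (- (t * w + t\<^sup>2 * b)) + \<i> * of_real (r * w + 2 * r * t * b)"
        unfolding that[symmetric] by (simp add: complex_eq_iff power2_eq_square algebra_simps)
      thus ?thesis
        unfolding h_def cis_conv_exp scaleR_conv_of_real exp_of_real[symmetric] exp_add[symmetric] by (simp only:)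
    qed
    have vint: "(\<lambda>t. h (Complex r t) / (Complex r t - p)) integrable_on {0..H}" if "r \<noteq> 0" for r
    proof (rule integrable_continuous_real)
      have "p \<noteq> Complex r t" for t using that by (auto simp: p_def complex_eq_iff)
      hence "continuous_on {0..H} ((\<lambda>z. h z / (z - p)) \<circ> Complex r)"
        by (intro continuous_on_compose cont) (auto simp: Complex_eq intro!: continuous_intros)
      thus "continuous_on {0..H} (\<lambda>t. h (Complex r t) / (Complex r t - p))" by (simp add: o_def)
    qed
    have 2: "contour_integral (linepath a2 a3) (\<lambda>z. h z / (z - p)) = \<i> * integral {0..H} (\<lambda>t. h (Complex L t) / (Complex L t - p))"
      by (rule contour_integral_linepath_same_Re) (use H in \<open>auto simp: a_def\<close>)
    have 4: "contour_integral (linepath a4 a1) (\<lambda>z. h z / (z - p)) = - (\<i> * integral {0..H} (\<lambda>t. h (Complex (- L) t) / (Complex (- L) t - p)))"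
    proof -
      have "contour_integral (linepath a1 a4) (\<lambda>z. h z / (z - p)) = \<i> * integral {0..H} (\<lambda>t. h (Complex (- L) t) / (Complex (- L) t - p))"
        by (rule contour_integral_linepath_same_Re) (use H in \<open>auto simp: a_def\<close>)
      moreover have "contour_integral (linepath a4 a1) (\<lambda>z. h z / (z - p)) = - contour_integral (linepath a1 a4) (\<lambda>z. h z / (z - p))"
        using contour_integral_reversepath[of "linepath a1 a4" "\<lambda>z. h z / (z - p)"] by simp
      ultimately show ?thesis by simp
    qed
    have "integral {0..H} (\<lambda>t. h (Complex L t) / (Complex L t - p)) - integral {0..H} (\<lambda>t. h (Complex (- L) t) / (Complex (- L) t - p))
        = integral {0..H} (\<lambda>t. h (Complex L t) / (Complex L t - p) - h (Complex (- L) t) / (Complex (- L) t - p))"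
      by (rule Henstock_Kurzweil_Integration.integral_diff[symmetric]) (use vint L in auto)
    also have "\<dots> = integral {0..H} (\<lambda>t. of_real (2 * side b L c w t))"
    proof (rule Henstock_Kurzweil_Integration.integral_cong)
      fix t
      \<comment> \<open>Reflection in the imaginary axis conjugates \<open>h\<close>, and it
        conjugates \<open>z - p\<close> up to sign, so the two vertical sides combine into twice a
        real part.\<close>
      have d: "Complex L t - p = Complex L (t - c)" "Complex (- L) t - p = - cnj (Complex L (t - c))"
        by (auto simp: p_def complex_eq_iff)
      have e: "cis (- L * w + 2 * - L * t * b) = cnj (cis (L * w + 2 * L * t * b))"
        unfolding cis_cnj by (rule arg_cong[of _ _ cis]) simp
      have fold: "r *\<^sub>R x / v - r *\<^sub>R cnj x / - cnj v = of_real (2 * (r * Re (x / v)))" for r x v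
      proof -
        have "r *\<^sub>R x / v - r *\<^sub>R cnj x / - cnj v = of_real r * (x / v + cnj (x / v))"
          by (simp add: scaleR_conv_of_real distrib_left)
        thus ?thesis unfolding complex_add_cnj by simp
      qed
      show "h (Complex L t) / (Complex L t - p) - h (Complex (- L) t) / (Complex (- L) t - p) = of_real (2 * side b L c w t)"
        unfolding hside[OF refl] hside[OF power2_minus] d e side_def by (rule fold)
    qed
    also have "\<dots> = of_real (2 * integral {0..H} (side b L c w))"
    proof -
      have "side b L c w integrable_on {0..H}"
      proof (rule set_borel_integral_eq_integral(1))
        show "set_integrable lborel {0..H} (side b L c w)"
          unfolding set_integrable_def
          by (rule Bochner_Integration.integrable_bound[OF side_integrable[OF L b, of c w]])
             (auto simp: indicator_def)
      qed
      hence "((\<lambda>t. 2 * side b L c w t) has_integral 2 * integral {0..H} (side b L c w)) {0..H}"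
        by (intro has_integral_mult_right integrable_integral)
      from has_integral_of_real[OF this] show ?thesis by (rule integral_unique)
    qed
    finally have 24: "integral {0..H} (\<lambda>t. h (Complex L t) / (Complex L t - p)) - integral {0..H} (\<lambda>t. h (Complex (- L) t) / (Complex (- L) t - p))
        = of_real (2 * integral {0..H} (side b L c w))" .
    have 3: "contour_integral (linepath a3 a4) (\<lambda>z. h z / (z - p)) = top H" by (simp add: top_def a_def)
    have "\<i> * kern y L c w + \<i> * of_real (2 * integral {0..H} (side b L c w)) + top H = R"
      using sum unfolding 1 2 3 4 24[symmetric] by (simp add: algebra_simps)
    thus ?thesis by (simp add: mult_ac)
  qed
  \<comment> \<open>On the top side \<open>|Re z| \<le> L\<close> gives
    \<open>|h z| \<le> exp (- (H * w + H^2 * b))\<close>; as \<open>b > 0\<close>, the quadratic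
    term prevails for either sign of \<open>w\<close>.\<close>
  have top: "(top \<longlongrightarrow> 0) at_top"
  proof (rule Lim_null_comparison)
    show "eventually (\<lambda>H. norm (top H) \<le> exp (- (H * w + H\<^sup>2 * b)) * (2 * L)) at_top"
      using eventually_ge_at_top[of "max 1 (c + 1)"]
    proof eventually_elim
      case (elim H)
      have np: "p \<notin> closed_segment (Complex L H) (Complex (- L) H)"
        using elim by (auto simp: closed_segment_same_Im p_def)
      have "norm (top H) \<le> exp (- (H * w + H\<^sup>2 * b)) * norm (Complex (- L) H - Complex L H)"
      proof (rule has_contour_integral_bound_linepath)
        show "((\<lambda>z. h z / (z - p)) has_contour_integral top H) (linepath (Complex L H) (Complex (- L) H))"
          unfolding top_def h_def using np
          by (intro has_contour_integral_integral contour_integrable_continuous_linepath continuous_intros) auto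
        fix z assume "z \<in> closed_segment (Complex L H) (Complex (- L) H)"
        hence z: "Im z = H" "\<bar>Re z\<bar> \<le> L" using L by (auto simp: closed_segment_same_Im closed_segment_eq_real_ivl)
        have "1 \<le> H - c" using elim by simp
        also have "\<dots> \<le> norm (z - p)" using abs_Im_le_cmod[of "z - p"] z by (simp add: p_def)
        finally have d: "1 \<le> norm (z - p)" .
        have "norm (h z) = exp (- (H * w + H\<^sup>2 * b) - (L\<^sup>2 - (Re z)\<^sup>2) * b)"
          unfolding h_def norm_exp_eq_Re using z
          by (simp add: power2_eq_square algebra_simps)
        also have "\<dots> \<le> exp (- (H * w + H\<^sup>2 * b))"
          using z b abs_le_square_iff[of "Re z" L] L by simp
        finally have "norm (h z) \<le> exp (- (H * w + H\<^sup>2 * b))" .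
        with d show "norm (h z / (z - p)) \<le> exp (- (H * w + H\<^sup>2 * b))"
          by (simp add: norm_divide divide_simps) (smt (verit) exp_gt_zero mult_left_mono mult_cancel_left1)
      qed simp
      also have "norm (Complex (- L) H - Complex L H) = 2 * L"
        using L by (simp add: cmod_def real_sqrt_mult)
      finally show ?case .
    qed
    show "((\<lambda>H. exp (- (H * w + H\<^sup>2 * b)) * (2 * L)) \<longlongrightarrow> 0) at_top"
      using b by real_asymp
  qed
  have "((\<lambda>H. \<i> * kern y L c w + 2 * \<i> * of_real (integral {0..H} (side b L c w)) + top H) \<longlongrightarrow>
     \<i> * kern y L c w + 2 * \<i> * of_real (\<integral>t. indicator {0..} t *\<^sub>R side b L c w t \<partial>lborel) + 0) at_top"
    by (intro tendsto_intros top tendsto_integral_Icc_at_top side_integrable L b)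
  moreover have "eventually (\<lambda>H. \<i> * kern y L c w + 2 * \<i> * of_real (integral {0..H} (side b L c w)) + top H = R) at_top"
    using eventually_gt_at_top[of "max 0 c"] by eventually_elim (use main in auto)
  hence "((\<lambda>H. \<i> * kern y L c w + 2 * \<i> * of_real (integral {0..H} (side b L c w)) + top H) \<longlongrightarrow> R) at_top"
    by (rule tendsto_eventually)
  ultimately have "R = \<i> * kern y L c w + 2 * \<i> * of_real (\<integral>t. indicator {0..} t *\<^sub>R side b L c w t \<partial>lborel) + 0"
    by (intro tendsto_unique[of at_top]) auto
  hence "\<i> * kern y L c w = \<i> * of_real (2 * pi * heaviside c * exp (- (c * w) + (c\<^sup>2 + L\<^sup>2) * y)
           - 2 * (\<integral>t. indicator {0..} t *\<^sub>R side b L c w t \<partial>lborel))"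
    unfolding R_def hp by (simp add: algebra_simps)
  thus ?thesis unfolding b_def[symmetric] by (simp only: mult_cancel_left) simp
qed

text \<open>Once the residue is removed, the rotated integral is all that remains; for
  \<open>w \<ge> 0\<close> it obeys the two half-line estimates.\<close>

lemma kern_neg_diff:
  assumes y: "y < 0" and L: "L > 0" and c: "c \<noteq> 0" and w: "w \<ge> 0"
  shows "norm (kern y L c w - of_real (2 * pi * heaviside c * exp (- (c * w) + (c\<^sup>2 + L\<^sup>2) * y))) \<le> 2 * sqrt (pi / \<bar>y\<bar>) / L"
    and "w \<noteq> 0 \<Longrightarrow> norm (kern y L c w - of_real (2 * pi * heaviside c * exp (- (c * w) + (c\<^sup>2 + L\<^sup>2) * y))) \<le> 2 / (L * \<bar>w\<bar>)"
proof -
  have eq: "norm (kern y L c w - of_real (2 * pi * heaviside c * exp (- (c * w) + (c\<^sup>2 + L\<^sup>2) * y)))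
     = 2 * \<bar>\<integral>t. indicator {0..} t *\<^sub>R side (- y) L c w t \<partial>lborel\<bar>"
    unfolding kern_rotate[OF y L c] of_real_diff[symmetric] norm_of_real by simp
  show "norm (kern y L c w - of_real (2 * pi * heaviside c * exp (- (c * w) + (c\<^sup>2 + L\<^sup>2) * y))) \<le> 2 * sqrt (pi / \<bar>y\<bar>) / L"
    unfolding eq using side_integral_le_sqrt[OF L _ w, of "- y" c] y by simp
  show "norm (kern y L c w - of_real (2 * pi * heaviside c * exp (- (c * w) + (c\<^sup>2 + L\<^sup>2) * y))) \<le> 2 / (L * \<bar>w\<bar>)" if "w \<noteq> 0"
    unfolding eq using side_integral_le_inverse[OF L, of "- y" w c] y w that by (simp add: mult.commute)
qed

text \<open>Reflection turns \<open>heaviside c\<close> into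
  \<open>heaviside (- c) = 1 - heaviside c\<close>: for \<open>w < 0\<close> the path is in effect
  rotated downwards and meets the pole only when \<open>c < 0\<close>.\<close>

lemma kern_neg_diff':
  assumes y: "y < 0" and L: "L > 0" and c: "c \<noteq> 0" and w: "w < 0"
  shows "norm (kern y L c w + of_real (2 * pi * (1 - heaviside c) * exp (- (c * w) + (c\<^sup>2 + L\<^sup>2) * y))) \<le> 2 * sqrt (pi / \<bar>y\<bar>) / L"
    and "norm (kern y L c w + of_real (2 * pi * (1 - heaviside c) * exp (- (c * w) + (c\<^sup>2 + L\<^sup>2) * y))) \<le> 2 / (L * \<bar>w\<bar>)"
proof -
  have h: "heaviside (- c) = 1 - heaviside c" using c by (simp add: heaviside_def)
  have eq: "norm (kern y L c w + of_real (2 * pi * (1 - heaviside c) * exp (- (c * w) + (c\<^sup>2 + L\<^sup>2) * y)))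
     = norm (kern y L (- c) (- w) - of_real (2 * pi * heaviside (- c) * exp (- ((- c) * (- w)) + ((- c)\<^sup>2 + L\<^sup>2) * y)))"
    unfolding kern_reflect h by (subst norm_minus_cancel[symmetric]) simp
  show "norm (kern y L c w + of_real (2 * pi * (1 - heaviside c) * exp (- (c * w) + (c\<^sup>2 + L\<^sup>2) * y))) \<le> 2 * sqrt (pi / \<bar>y\<bar>) / L"
    unfolding eq by (rule kern_neg_diff) (use assms in auto)
  show "norm (kern y L c w + of_real (2 * pi * (1 - heaviside c) * exp (- (c * w) + (c\<^sup>2 + L\<^sup>2) * y))) \<le> 2 / (L * \<bar>w\<bar>)"
    unfolding eq using kern_neg_diff(2)[of y L "- c" "- w"] assms by simp
qed

section \<open>Normal form of the Green function\<close>

text \<open>The share of the first exponential in the common denominator of \<open>sato_chi\<close>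
  and \<open>sato_xi\<close>; in these terms both become convex combinations.\<close>

definition wt :: "real \<Rightarrow> real \<Rightarrow> real \<Rightarrow> real \<times> real \<Rightarrow> real" where
  "wt k1 k2 a x = exp (theta_phase k1 x) / (exp (theta_phase k1 x) + a * exp (theta_phase k2 x))"

text \<open>The residue at \<open>k1\<close> of the product of \<open>sato_chi\<close> at
  \<open>x\<close> and \<open>sato_xi\<close> at \<open>x'\<close>; \<open>coef2\<close> is the one
  at \<open>k2\<close>.\<close>

definition coef1 :: "real \<Rightarrow> real \<Rightarrow> real \<Rightarrow> real \<times> real \<Rightarrow> real \<times> real \<Rightarrow> real" where
  "coef1 k1 k2 a x x' = - ((k2 - k1) * (1 - wt k1 k2 a x) * wt k1 k2 a x')"

definition coef2 :: "real \<Rightarrow> real \<Rightarrow> real \<Rightarrow> real \<times> real \<Rightarrow> real \<times> real \<Rightarrow> real" where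
  "coef2 k1 k2 a x x' = (k2 - k1) * wt k1 k2 a x * (1 - wt k1 k2 a x')"

text \<open>The exponential of a discrete term, i.e. the value at the pole \<open>s = i c\<close> of \<open>e\<^bsup>i s w - (s\<^sup>2 - L\<^sup>2) y\<^esup>\<close>.\<close>

definition expo :: "real \<Rightarrow> real \<Rightarrow> real \<Rightarrow> real \<Rightarrow> real" where
  "expo y L w c = exp (- (c * w) + (c\<^sup>2 + L\<^sup>2) * y)"

text \<open>
  The exponent of \<open>e\<^bsup>(\<mu> - \<lambda>)(x\<^sub>1 - x\<^sub>1') + (\<mu>\<^sup>2 - \<lambda>\<^sup>2)y\<^esup>\<close> at \<open>\<mu> = \<lambda>\<^sub>R + i s\<close> is
  \<open>i (s - \<lambda>\<^sub>I) w - (s\<^sup>2 - \<lambda>\<^sub>I\<^sup>2) y\<close> with \<open>w\<close> the following quantity.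
\<close>

definition shear :: "real \<times> real \<Rightarrow> real \<times> real \<Rightarrow> complex \<Rightarrow> real" where
  "shear x x' l = fst x - fst x' + 2 * Re l * (snd x - snd x')"

text \<open>The Green function up to a unimodular factor, in scalar variables only. Of the
  coefficients, the estimates use a common bound and the cancellation relation between the two
  discrete terms.\<close>

definition green_normal :: "real \<Rightarrow> real \<Rightarrow> real \<Rightarrow> real \<Rightarrow> real \<Rightarrow> real \<Rightarrow> real \<Rightarrow> complex" where
  "green_normal y L w c1 c2 A1 A2 =
     - of_real (sgn y / (2 * pi)) * (kern0 y L w + of_real A1 * kern y L c1 w + of_real A2 * kern y L c2 w)
     - of_real (heaviside (- y) * (heaviside c1 * A1 * expo y L w c1 + heaviside c2 * A2 * expo y L w c2))"

section \<open>Partial fractions, residues and reduction to the normal form\<close>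

context
  fixes k1 k2 a :: real
  assumes a: "a > 0"
begin

lemma denom_pos: "exp (theta_phase k1 x) + a * exp (theta_phase k2 x) > 0"
  using a by (simp add: add_pos_pos)

lemma wt_compl: "1 - wt k1 k2 a x = a * exp (theta_phase k2 x) / (exp (theta_phase k1 x) + a * exp (theta_phase k2 x))"
  using denom_pos[of x] by (simp add: wt_def field_simps)

lemma wt_bounds: "0 \<le> wt k1 k2 a x" "wt k1 k2 a x \<le> 1"
  using a denom_pos[of x] by (auto simp: wt_def divide_simps)

lemma abs_coef_le:
  assumes "k1 < k2"
  shows "\<bar>coef1 k1 k2 a x x'\<bar> \<le> k2 - k1" "\<bar>coef2 k1 k2 a x x'\<bar> \<le> k2 - k1"
proof -
  have *: "\<bar>(k2 - k1) * u * v\<bar> \<le> k2 - k1" if "0 \<le> u" "u \<le> 1" "0 \<le> v" "v \<le> 1" for u v :: real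
    using mult_left_mono[OF mult_le_one[OF that(2,3,4)], of "k2 - k1"] that assms
    by (simp add: abs_mult mult.assoc)
  show "\<bar>coef1 k1 k2 a x x'\<bar> \<le> k2 - k1" "\<bar>coef2 k1 k2 a x x'\<bar> \<le> k2 - k1"
    unfolding coef1_def coef2_def abs_minus_cancel using wt_bounds[of x] wt_bounds[of x'] by (auto intro!: *)
qed

lemma sato_chi_eq:
  "sato_chi k1 k2 a x l = (1 - of_real k1 / l) * of_real (wt k1 k2 a x) + (1 - of_real k2 / l) * of_real (1 - wt k1 k2 a x)"
  unfolding sato_chi_def wt_compl unfolding wt_def of_real_divide by (simp add: add_divide_distrib)

lemma sato_xi_eq:
  "sato_xi k1 k2 a x l = of_real (wt k1 k2 a x) / (1 - of_real k1 / l) + of_real (1 - wt k1 k2 a x) / (1 - of_real k2 / l)"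
  unfolding sato_xi_def wt_compl unfolding wt_def of_real_divide by (simp add: add_divide_distrib mult.commute)

text \<open>Writing \<open>1 - K / l = (l - K) / l\<close> cancels the powers of \<open>l\<close>,
  so the singularity at 0 is removable; simple poles at \<open>K1\<close>, \<open>K2\<close> and the
  value 1 at infinity determine the expansion.\<close>

lemma chi_xi_partial_fractions:
  fixes l K1 K2 p q :: complex
  assumes "l \<noteq> 0" "l \<noteq> K1" "l \<noteq> K2"
  shows "((1 - K1 / l) * p + (1 - K2 / l) * (1 - p)) * (q / (1 - K1 / l) + (1 - q) / (1 - K2 / l))
    = 1 + (- ((K2 - K1) * (1 - p) * q)) / (l - K1) + ((K2 - K1) * p * (1 - q)) / (l - K2)"
proof -
  have e: "1 - K / l = (l - K) / l" for K using assms(1) by (simp add: field_simps)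
  have ne: "l - K1 \<noteq> 0" "l - K2 \<noteq> 0" using assms by auto
  show ?thesis
    unfolding e using assms(1) ne by (simp add: divide_simps) (simp add: algebra_simps)
qed

lemma phi_psi_eq:
  assumes "l \<noteq> 0" "l \<noteq> of_real k1" "l \<noteq> of_real k2"
  shows "sato_phi k1 k2 a x l * sato_psi k1 k2 a x' l =
    exp (l * of_real (fst x - fst x') + l\<^sup>2 * of_real (snd x - snd x'))
     * (1 + of_real (coef1 k1 k2 a x x') / (l - of_real k1) + of_real (coef2 k1 k2 a x x') / (l - of_real k2))"
proof -
  have "sato_chi k1 k2 a x l * sato_xi k1 k2 a x' l =
    1 + of_real (coef1 k1 k2 a x x') / (l - of_real k1) + of_real (coef2 k1 k2 a x x') / (l - of_real k2)"
    unfolding sato_chi_eq sato_xi_eq coef1_def coef2_def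
    using chi_xi_partial_fractions[OF assms, of "of_real (wt k1 k2 a x)" "of_real (wt k1 k2 a x')"] by simp
  moreover have "exp (l * of_real (fst x) + l\<^sup>2 * of_real (snd x)) * exp (- (l * of_real (fst x') + l\<^sup>2 * of_real (snd x')))
     = exp (l * of_real (fst x - fst x') + l\<^sup>2 * of_real (snd x - snd x'))"
    unfolding exp_add[symmetric] by (rule arg_cong[of _ _ exp]) (simp add: algebra_simps)
  moreover have "sato_phi k1 k2 a x l * sato_psi k1 k2 a x' l =
     (exp (l * of_real (fst x) + l\<^sup>2 * of_real (snd x)) * exp (- (l * of_real (fst x') + l\<^sup>2 * of_real (snd x'))))
       * (sato_chi k1 k2 a x l * sato_xi k1 k2 a x' l)"
    unfolding sato_phi_def sato_psi_def by (simp only: mult_ac)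
  ultimately show ?thesis by (simp only:)
qed

text \<open>As \<open>p / (1 - k / l) = p * l / (l - k)\<close>, the first summand contributes
  \<open>k * p\<close>, while the second is holomorphic near \<open>k\<close>.\<close>

lemma residue_two_poles:
  fixes k k' :: real and p q :: complex
  assumes "k \<noteq> 0" "k \<noteq> k'"
  shows "residue (\<lambda>l. exp (- (l * of_real u + l\<^sup>2 * of_real v)) * (p / (1 - of_real k / l) + q / (1 - of_real k' / l))) (of_real k)
     = exp (- (of_real k * of_real u + (of_real k)\<^sup>2 * of_real v)) * (of_real k * p)"
proof -
  let ?f = "\<lambda>l. exp (- (l * of_real u + l\<^sup>2 * of_real v)) * (p * l + q * l * (l - of_real k) / (l - of_real k'))"
  have "residue (\<lambda>l. exp (- (l * of_real u + l\<^sup>2 * of_real v)) * (p / (1 - of_real k / l) + q / (1 - of_real k' / l))) (of_real k)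
     = residue (\<lambda>l. ?f l / (l - of_real k)) (of_real k)"
  proof (rule residue_cong)
    have "eventually (\<lambda>l. l \<in> - {0, of_real k', of_real k}) (at (complex_of_real k))"
      using eventually_at_in_open'[of "- {0, complex_of_real k'}" "complex_of_real k"] assms
        eventually_neq_at_within[of "complex_of_real k" "complex_of_real k" UNIV]
      by (auto simp: open_Compl eventually_conj_iff elim: eventually_elim2)
    thus "eventually (\<lambda>l. exp (- (l * of_real u + l\<^sup>2 * of_real v)) * (p / (1 - of_real k / l) + q / (1 - of_real k' / l))
        = ?f l / (l - of_real k)) (at (complex_of_real k))"
    proof eventually_elim
      case (elim l)
      have e: "1 - K / l = (l - K) / l" for K using elim by (simp add: field_simps)
      have ne: "l \<noteq> 0" "l - of_real k \<noteq> 0" "l - of_real k' \<noteq> 0" using elim by auto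
      have "p / (1 - of_real k / l) + q / (1 - of_real k' / l)
          = (p * l + q * l * (l - of_real k) / (l - of_real k')) / (l - of_real k)"
        unfolding e using ne by (simp add: divide_simps)
      thus ?case by simp
    qed
  qed simp
  also have "\<dots> = ?f (of_real k)"
    by (rule residue_simple[of "- {of_real k'}"])
       (use assms in \<open>auto intro!: holomorphic_intros simp: open_Compl\<close>)
  also have "\<dots> = exp (- (of_real k * of_real u + (of_real k)\<^sup>2 * of_real v)) * (of_real k * p)"
    by simp
  finally show ?thesis .
qed

lemma psi_res_eq:
  assumes "k1 \<noteq> 0" "k2 \<noteq> 0" "k1 \<noteq> k2"
  shows "psi_res k1 k2 a k1 x = exp (- (of_real k1 * of_real (fst x) + (of_real k1)\<^sup>2 * of_real (snd x))) * (of_real k1 * of_real (wt k1 k2 a x))"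
    and "psi_res k1 k2 a k2 x = exp (- (of_real k2 * of_real (fst x) + (of_real k2)\<^sup>2 * of_real (snd x))) * (of_real k2 * of_real (1 - wt k1 k2 a x))"
proof -
  show "psi_res k1 k2 a k1 x = exp (- (of_real k1 * of_real (fst x) + (of_real k1)\<^sup>2 * of_real (snd x))) * (of_real k1 * of_real (wt k1 k2 a x))"
    unfolding psi_res_def sato_psi_def[abs_def] sato_xi_eq by (rule residue_two_poles) (use assms in auto)
  show "psi_res k1 k2 a k2 x = exp (- (of_real k2 * of_real (fst x) + (of_real k2)\<^sup>2 * of_real (snd x))) * (of_real k2 * of_real (1 - wt k1 k2 a x))"
    unfolding psi_res_def sato_psi_def[abs_def] sato_xi_eq
    by (subst (2) add.commute, rule residue_two_poles) (use assms in auto)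
qed

text \<open>At each pole one summand of \<open>sato_chi\<close> vanishes, and the denominator in the
  other cancels against the factor \<open>k1\<close> or \<open>k2\<close> of the residue.\<close>

lemma phi_psi_res_eq:
  assumes "k1 \<noteq> 0" "k2 \<noteq> 0" "k1 \<noteq> k2"
  shows "phi_at k1 k2 a k1 x * psi_res k1 k2 a k1 x' =
      exp (of_real k1 * of_real (fst x - fst x') + (of_real k1)\<^sup>2 * of_real (snd x - snd x')) * of_real (coef1 k1 k2 a x x')"
    and "phi_at k1 k2 a k2 x * psi_res k1 k2 a k2 x' =
      exp (of_real k2 * of_real (fst x - fst x') + (of_real k2)\<^sup>2 * of_real (snd x - snd x')) * of_real (coef2 k1 k2 a x x')"
proof -
  have e: "exp (of_real k * of_real (fst x - fst x') + (of_real k)\<^sup>2 * of_real (snd x - snd x')) =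
     exp (of_real k * of_real (fst x) + (of_real k)\<^sup>2 * of_real (snd x)) * exp (- (of_real k * of_real (fst x') + (of_real k)\<^sup>2 * of_real (snd x')) :: complex)" for k
    unfolding exp_add[symmetric] by (rule arg_cong[of _ _ exp]) (simp add: algebra_simps)
  show "phi_at k1 k2 a k1 x * psi_res k1 k2 a k1 x' =
      exp (of_real k1 * of_real (fst x - fst x') + (of_real k1)\<^sup>2 * of_real (snd x - snd x')) * of_real (coef1 k1 k2 a x x')"
    unfolding phi_at_def sato_phi_def sato_chi_eq psi_res_eq[OF assms] coef1_def e
    using assms by (simp add: field_simps)
  show "phi_at k1 k2 a k2 x * psi_res k1 k2 a k2 x' =
      exp (of_real k2 * of_real (fst x - fst x') + (of_real k2)\<^sup>2 * of_real (snd x - snd x')) * of_real (coef2 k1 k2 a x x')"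
    unfolding phi_at_def sato_phi_def sato_chi_eq psi_res_eq[OF assms] coef2_def e
    using assms by (simp add: field_simps)
qed

text \<open>This is \<open>\<phi>\<^sub>1(x)\<psi>\<^sub>1(x') + \<phi>\<^sub>2(x)\<psi>\<^sub>2(x') = 0\<close>.\<close>

lemma coef_cancel:
  fixes l x x'
  defines "y \<equiv> snd x - snd x'" and "w \<equiv> shear x x' l"
  shows "coef1 k1 k2 a x x' * expo y L w (Re l - k1) + coef2 k1 k2 a x x' * expo y L w (Re l - k2) = 0"
proof -
  \<comment> \<open>\<open>B\<close> is the part of the exponent of \<open>expo\<close> independent
    of \<open>k\<close>. With it, both products equal, up to sign,
    \<open>(k2 - k1) * a * exp B\<close> times the two exponentials at \<open>x\<close>, divided by
    the denominators at \<open>x\<close> and \<open>x'\<close>.\<close>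
  define B where "B = - Re l * (fst x - fst x') - ((Re l)\<^sup>2 - L\<^sup>2) * y"
  have e: "expo y L w (Re l - k) = exp B * (exp (theta_phase k x) / exp (theta_phase k x'))" for k
    unfolding expo_def exp_diff[symmetric] exp_add[symmetric]
    by (rule arg_cong[of _ _ exp])
       (simp add: B_def w_def y_def shear_def theta_phase_def power2_eq_square algebra_simps)
  show ?thesis
    unfolding coef1_def coef2_def wt_compl unfolding e wt_def by (simp add: mult_ac)
qed

text \<open>The exponential prefactor is absorbed into the exponentials of the Sato functions; along
  the path this leaves a phase times the real exponential in \<open>env\<close>, and at the poles it
  leaves \<open>expo\<close>.\<close>

lemma green_formula_eq_normal:
  fixes l x x'
  defines "y \<equiv> snd x - snd x'" and "w \<equiv> shear x x' l"
  assumes k: "k1 \<noteq> 0" "k2 \<noteq> 0" "k1 \<noteq> k2" and l: "Re l \<noteq> k1" "Re l \<noteq> k2" and y: "snd x \<noteq> snd x'"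
  shows "green_formula k1 k2 a x x' l = cis (- (Im l * w)) *
     green_normal y \<bar>Im l\<bar> w (Re l - k1) (Re l - k2) (coef1 k1 k2 a x x') (coef2 k1 k2 a x x')"
proof -
  define L where "L = \<bar>Im l\<bar>"
  define A1 A2 where "A1 = coef1 k1 k2 a x x'" "A2 = coef2 k1 k2 a x x'"
  define P where "P = exp (- l * of_real (fst x - fst x') - l\<^sup>2 * of_real y)"
  have y0: "y \<noteq> 0" and L0: "L \<ge> 0" and L2: "L\<^sup>2 = (Im l)\<^sup>2" using y by (auto simp: y_def L_def)
  have c: "Re l - k1 \<noteq> 0" "Re l - k2 \<noteq> 0" using l by auto
  have phase: "P * exp (m * of_real (fst x - fst x') + m\<^sup>2 * of_real y)
      = cis (- (Im l * w)) * cis (Im m * w) * of_real (exp (- (((Im m)\<^sup>2 - L\<^sup>2) * y)))" if "Re m = Re l" for m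
    unfolding P_def cis_conv_exp exp_of_real[symmetric] exp_add[symmetric] L2
    by (rule arg_cong[of _ _ exp])
       (use that in \<open>simp add: complex_eq_iff w_def shear_def y_def power2_eq_square algebra_simps\<close>)
  have phase': "P * exp (of_real k * of_real (fst x - fst x') + (of_real k)\<^sup>2 * of_real y)
      = cis (- (Im l * w)) * of_real (expo y L w (Re l - k))" for k
    unfolding P_def cis_conv_exp expo_def exp_of_real[symmetric] exp_add[symmetric] L2
    by (rule arg_cong[of _ _ exp])
       (simp add: complex_eq_iff w_def shear_def y_def power2_eq_square algebra_simps)
  let ?F = "\<lambda>s. of_real (heaviside ((s\<^sup>2 - (Im l)\<^sup>2) * (snd x - snd x')))
             * sato_phi k1 k2 a x (Complex (Re l) s) * sato_psi k1 k2 a x' (Complex (Re l) s)"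
  let ?T = "\<lambda>s. of_real (env y L s) * cis (s * w)"
  \<comment> \<open>Excluding \<open>s = 0\<close> avoids the point where
    \<open>Complex (Re l) s\<close> can be 0; it is a null set for the integral.\<close>
  have pt: "P * ?F s = cis (- (Im l * w)) * (?T s + of_real A1 * (?T s / Complex (Re l - k1) s) + of_real A2 * (?T s / Complex (Re l - k2) s))"
    if "s \<noteq> 0" for s
  proof -
    have ne: "Complex (Re l) s \<noteq> 0" "Complex (Re l) s \<noteq> of_real k1" "Complex (Re l) s \<noteq> of_real k2"
      using that l by (auto simp: complex_eq_iff)
    have d: "Complex (Re l) s - of_real k = Complex (Re l - k) s" for k by (simp add: complex_eq_iff)
    have "P * ?F s = of_real (heaviside ((s\<^sup>2 - L\<^sup>2) * y)) * (P * (sato_phi k1 k2 a x (Complex (Re l) s) * sato_psi k1 k2 a x' (Complex (Re l) s)))"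
      unfolding L2 y_def by (simp add: mult_ac)
    also have "\<dots> = of_real (heaviside ((s\<^sup>2 - L\<^sup>2) * y)) * (P * exp (Complex (Re l) s * of_real (fst x - fst x') + (Complex (Re l) s)\<^sup>2 * of_real y))
        * (1 + of_real A1 / Complex (Re l - k1) s + of_real A2 / Complex (Re l - k2) s)"
      unfolding phi_psi_eq[OF ne] d A1_A2_def y_def by (simp add: mult_ac)
    also have "\<dots> = cis (- (Im l * w)) * (?T s * (1 + of_real A1 / Complex (Re l - k1) s + of_real A2 / Complex (Re l - k2) s))"
      using phase[of "Complex (Re l) s"] by (simp add: env_def mult_ac)
    finally show ?thesis by (simp add: algebra_simps)
  qed
  have "P * (\<integral>s. ?F s \<partial>lborel) = (\<integral>s. P * ?F s \<partial>lborel)"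
    by simp
  also have "\<dots> = (\<integral>s. cis (- (Im l * w)) * (?T s + of_real A1 * (?T s / Complex (Re l - k1) s) + of_real A2 * (?T s / Complex (Re l - k2) s)) \<partial>lborel)"
  proof (rule integral_cong_AE)
    show "AE s in lborel. P * ?F s = cis (- (Im l * w)) * (?T s + of_real A1 * (?T s / Complex (Re l - k1) s) + of_real A2 * (?T s / Complex (Re l - k2) s))"
      using AE_lborel_singleton[of 0] by eventually_elim (rule pt)
    show "(\<lambda>s. P * ?F s) \<in> borel_measurable lborel"
      unfolding sato_phi_def sato_psi_def sato_chi_def sato_xi_def by measurable
  qed measurable
  also have "\<dots> = cis (- (Im l * w)) * (kern0 y L w + of_real A1 * kern y L (Re l - k1) w + of_real A2 * kern y L (Re l - k2) w)"
  proof -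
    note i = kern0_integrable[OF L0 y0, of w]
      integrable_mult_right[OF kern_integrable[OF L0 y0 c(1), of w], of "of_real A1"]
      integrable_mult_right[OF kern_integrable[OF L0 y0 c(2), of w], of "of_real A2"]
    show ?thesis
      unfolding kern0_def kern_def integral_mult_right_zero
        Bochner_Integration.integral_add[OF Bochner_Integration.integrable_add[OF i(1,2)] i(3)]
        Bochner_Integration.integral_add[OF i(1,2)] by simp
  qed
  finally have int: "P * (\<integral>s. ?F s \<partial>lborel) = cis (- (Im l * w)) * (kern0 y L w + of_real A1 * kern y L (Re l - k1) w + of_real A2 * kern y L (Re l - k2) w)" .
  have "P * green_cont k1 k2 a x x' l = - of_real (sgn y / (2 * pi)) * (P * (\<integral>s. ?F s \<partial>lborel))"
    unfolding green_cont_def y_def by (simp only: mult_ac)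
  moreover have "P * green_disc k1 k2 a x x' l = - cis (- (Im l * w)) * of_real (heaviside (- y) *
       (heaviside (Re l - k1) * A1 * expo y L w (Re l - k1) + heaviside (Re l - k2) * A2 * expo y L w (Re l - k2)))"
  proof -
    have "P * green_disc k1 k2 a x x' l = - of_real (heaviside (- y)) *
       (of_real (heaviside (Re l - k1)) * A1 * (P * exp (of_real k1 * of_real (fst x - fst x') + (of_real k1)\<^sup>2 * of_real y))
      + of_real (heaviside (Re l - k2)) * A2 * (P * exp (of_real k2 * of_real (fst x - fst x') + (of_real k2)\<^sup>2 * of_real y)))"
      unfolding green_disc_def mult.assoc phi_psi_res_eq[OF k] A1_A2_def y_def by (simp add: algebra_simps)
    thus ?thesis unfolding phase' by (simp add: algebra_simps)
  qed
  ultimately have "green_formula k1 k2 a x x' l = - of_real (sgn y / (2 * pi)) * (P * (\<integral>s. ?F s \<partial>lborel)) + - cis (- (Im l * w)) * of_real (heaviside (- y) *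
       (heaviside (Re l - k1) * A1 * expo y L w (Re l - k1) + heaviside (Re l - k2) * A2 * expo y L w (Re l - k2)))"
    unfolding green_formula_def P_def y_def by (simp only: distrib_left)
  thus ?thesis
    unfolding int green_normal_def A1_A2_def[symmetric] L_def[symmetric] by (simp add: algebra_simps)
qed

text \<open>With \<open>sgn 0 = 0\<close> and \<open>heaviside 0 = 0\<close>, both the continuous
  and the discrete part vanish.\<close>

lemma green_formula_same_time:
  assumes "snd x = snd x'"
  shows "green_formula k1 k2 a x x' l = 0"
  using assms by (simp add: green_formula_def green_cont_def green_disc_def heaviside_def)

end

section \<open>Bounds off the singular lines\<close>

lemma sqrt_pi_le: "sqrt pi \<le> 2"
  using pi_less_4 real_sqrt_le_mono[of pi 4] by simp

lemma sqrt_pi_divide_le: "sqrt (pi / \<bar>y\<bar>) \<le> 2 * (1 / sqrt \<bar>y\<bar>)"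
  using divide_right_mono[OF sqrt_pi_le, of "sqrt \<bar>y\<bar>"] by (simp add: real_sqrt_divide)

text \<open>If \<open>c1\<close> and \<open>c2\<close> have equal signs, the sum is empty or
  cancels. Otherwise one term remains, and cancellation allows exchanging it for the other, so that
  the one with \<open>c * w \<ge> 0\<close> is estimated. Taking \<open>r = 0\<close> gives
  boundedness, \<open>r > 0\<close> gives decay.\<close>

lemma disc_sum_le:
  assumes c: "c2 < c1" and r: "0 \<le> r" "r \<le> \<bar>c1\<bar>" "r \<le> \<bar>c2\<bar>" and c0: "c1 \<noteq> 0" "c2 \<noteq> 0"
    and y: "y < 0" and A: "\<bar>A1\<bar> \<le> d" "\<bar>A2\<bar> \<le> d"
    and cancel: "A1 * expo y L w c1 + A2 * expo y L w c2 = 0"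
  shows "\<bar>heaviside c1 * A1 * expo y L w c1 + heaviside c2 * A2 * expo y L w c2\<bar> \<le> d * exp (- (r * \<bar>w\<bar> + r\<^sup>2 * \<bar>y\<bar>))"
proof -
  have d: "d \<ge> 0" using A by linarith
  have E: "\<bar>A * expo y L w c\<bar> \<le> d * exp (- (r * \<bar>w\<bar> + r\<^sup>2 * \<bar>y\<bar>))"
    if "\<bar>A\<bar> \<le> d" "c * w = \<bar>c\<bar> * \<bar>w\<bar>" "r \<le> \<bar>c\<bar>" for A c
  proof -
    have "r\<^sup>2 \<le> c\<^sup>2" using that(3) r(1) by (metis power2_abs power_mono)
    hence "r\<^sup>2 * \<bar>y\<bar> \<le> (c\<^sup>2 + L\<^sup>2) * \<bar>y\<bar>" by (intro mult_right_mono) (auto simp: add_increasing2)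
    moreover have "r * \<bar>w\<bar> \<le> \<bar>c\<bar> * \<bar>w\<bar>" using that(3) by (intro mult_right_mono) auto
    moreover have "(c\<^sup>2 + L\<^sup>2) * y = - ((c\<^sup>2 + L\<^sup>2) * \<bar>y\<bar>)" using y by simp
    ultimately have "- (c * w) + (c\<^sup>2 + L\<^sup>2) * y \<le> - (r * \<bar>w\<bar> + r\<^sup>2 * \<bar>y\<bar>)"
      using that(2) by linarith
    hence "expo y L w c \<le> exp (- (r * \<bar>w\<bar> + r\<^sup>2 * \<bar>y\<bar>))" by (simp add: expo_def)
    thus ?thesis
      unfolding abs_mult using that(1) d by (intro mult_mono) (auto simp: expo_def)
  qed
  consider "c1 < 0" | "c2 > 0" | "c1 > 0" "c2 < 0" using c0 by linarith
  then show ?thesis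
  proof cases
    case 1 thus ?thesis using c d by (simp add: heaviside_def)
  next
    case 2 thus ?thesis using c d cancel by (simp add: heaviside_def)
  next
    case 3
    hence eq: "heaviside c1 * A1 * expo y L w c1 + heaviside c2 * A2 * expo y L w c2 = A1 * expo y L w c1"
      by (simp add: heaviside_def)
    show ?thesis
    proof (cases "w \<ge> 0")
      case True thus ?thesis unfolding eq using 3 by (intro E A r) auto
    next
      case False
      have "A1 * expo y L w c1 = - (A2 * expo y L w c2)" using cancel by linarith
      thus ?thesis unfolding eq using 3 False by (simp only: abs_minus_cancel, intro E A r) auto
    qed
  qed
qed

lemma norm_lin3_le:
  fixes u v t :: complex
  assumes "norm t \<le> T" "norm u \<le> U" "norm v \<le> U" "\<bar>A1\<bar> \<le> d" "\<bar>A2\<bar> \<le> d" "\<bar>s\<bar> \<le> 1"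
  shows "norm (of_real (s / (2 * pi)) * (t + of_real A1 * u + of_real A2 * v)) \<le> T + 2 * d * U"
proof -
  have "norm (t + of_real A1 * u + of_real A2 * v) \<le> norm t + norm (of_real A1 * u) + norm (of_real A2 * v)"
    by (intro norm_triangle_le add_mono order_refl) 
  also have "\<dots> \<le> T + d * U + d * U"
    unfolding norm_mult norm_of_real using assms by (intro add_mono mult_mono) auto
  finally have 1: "norm (t + of_real A1 * u + of_real A2 * v) \<le> T + 2 * d * U"
    by (simp only: mult_2 distrib_right add.assoc)
  have "\<bar>s\<bar> \<le> 2 * pi" using assms(6) pi_gt3 by linarith
  hence "\<bar>s / (2 * pi)\<bar> \<le> 1" by simp
  hence "norm (of_real (s / (2 * pi)) * (t + of_real A1 * u + of_real A2 * v)) \<le> 1 * (T + 2 * d * U)"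
    unfolding norm_mult norm_of_real using 1 by (intro mult_mono) auto
  thus ?thesis by simp
qed

text \<open>\<open>kern0\<close> contributes the inverse square root of \<open>|y|\<close>;
  \<open>kern\<close> and the discrete pair are bounded uniformly in the position of the
  poles.\<close>

lemma green_normal_bounded:
  assumes "d \<ge> 0"
  obtains C where "\<And>y L w c1 c2 A1 A2. y \<noteq> 0 \<Longrightarrow> L \<ge> 0 \<Longrightarrow> c2 < c1 \<Longrightarrow> c1 \<noteq> 0 \<Longrightarrow> c2 \<noteq> 0 \<Longrightarrow>
      \<bar>A1\<bar> \<le> d \<Longrightarrow> \<bar>A2\<bar> \<le> d \<Longrightarrow> A1 * expo y L w c1 + A2 * expo y L w c2 = 0 \<Longrightarrow>
      norm (green_normal y L w c1 c2 A1 A2) \<le> C * (1 + 1 / sqrt \<bar>y\<bar>)"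
proof -
  obtain B where B: "\<And>y L c w. L \<ge> 0 \<Longrightarrow> y \<noteq> 0 \<Longrightarrow> c \<noteq> 0 \<Longrightarrow> norm (kern y L c w) \<le> B"
    using kern_bounded by blast
  have "norm (kern 1 0 1 0) \<le> B" by (rule B) auto
  hence B0: "B \<ge> 0" by (rule order_trans[OF norm_ge_zero])
  have "norm (green_normal y L w c1 c2 A1 A2) \<le> (4 + 2 * d * B + d) * (1 + 1 / sqrt \<bar>y\<bar>)"
    if a: "y \<noteq> 0" "L \<ge> 0" "c2 < c1" "c1 \<noteq> 0" "c2 \<noteq> 0" "\<bar>A1\<bar> \<le> d" "\<bar>A2\<bar> \<le> d"
      "A1 * expo y L w c1 + A2 * expo y L w c2 = 0" for y L w c1 c2 A1 A2
  proof -
    define X where "X = 1 / sqrt \<bar>y\<bar>"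
    have X: "X \<ge> 0" by (simp add: X_def)
    have "norm (kern0 y L w) \<le> 4 * X"
      using norm_kern0_le_sqrt[OF a(2,1), of w] sqrt_pi_divide_le[of y] by (simp add: X_def)
    hence 1: "norm (of_real (- sgn y / (2 * pi)) * (kern0 y L w + of_real A1 * kern y L c1 w + of_real A2 * kern y L c2 w))
        \<le> 4 * X + 2 * d * B"
      by (intro norm_lin3_le B a) (auto simp: sgn_if)
    have 2: "\<bar>heaviside (- y) * (heaviside c1 * A1 * expo y L w c1 + heaviside c2 * A2 * expo y L w c2)\<bar> \<le> d"
    proof (cases "y < 0")
      case True
      thus ?thesis using disc_sum_le[of c2 c1 0 y A1 d A2 L w] a by (simp add: heaviside_def)
    next
      case False thus ?thesis using assms by (simp add: heaviside_def)
    qed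
    have eq: "green_normal y L w c1 c2 A1 A2 = of_real (- sgn y / (2 * pi)) * (kern0 y L w + of_real A1 * kern y L c1 w + of_real A2 * kern y L c2 w)
       - of_real (heaviside (- y) * (heaviside c1 * A1 * expo y L w c1 + heaviside c2 * A2 * expo y L w c2))"
      by (simp add: green_normal_def)
    have "norm (green_normal y L w c1 c2 A1 A2) \<le> (4 * X + 2 * d * B) + d"
      unfolding eq by (rule order_trans[OF norm_triangle_ineq4 add_mono[OF 1]]) (use 2 in \<open>simp only: norm_of_real\<close>)
    also have "\<dots> \<le> (4 + 2 * d * B + d) * (1 + X)"
      using X assms B0 by (simp add: algebra_simps add_increasing add_increasing2)
    finally show ?thesis by (simp add: X_def)
  qed
  thus ?thesis using that by blast
qed

text \<open>\<open>X\<close> is either \<open>1 / sqrt |y|\<close> or \<open>1 / |w|\<close>, so one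
  case analysis serves both decay estimates.\<close>

lemma green_normal_le_aux:
  assumes d: "d \<ge> 0" and r: "r > 0" "r \<le> L \<or> L = 0" and y: "y \<noteq> 0" and X: "X \<ge> 0"
    and A: "\<bar>A1\<bar> \<le> d" "\<bar>A2\<bar> \<le> d" and cancel: "A1 * expo y L w c1 + A2 * expo y L w c2 = 0"
    and t: "norm (kern0 y L w) \<le> 8 * X"
    and pos: "\<And>c. y > 0 \<Longrightarrow> c \<in> {c1, c2} \<Longrightarrow> norm (kern y L c w) \<le> 48 * (X / r)"
    and neg: "\<And>c. y < 0 \<Longrightarrow> r \<le> L \<Longrightarrow> w \<ge> 0 \<Longrightarrow> c \<in> {c1, c2} \<Longrightarrow>
       norm (kern y L c w - of_real (2 * pi * heaviside c * expo y L w c)) \<le> 48 * (X / r)"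
    and neg': "\<And>c. y < 0 \<Longrightarrow> r \<le> L \<Longrightarrow> w < 0 \<Longrightarrow> c \<in> {c1, c2} \<Longrightarrow>
       norm (kern y L c w + of_real (2 * pi * (1 - heaviside c) * expo y L w c)) \<le> 48 * (X / r)"
    and zero: "y < 0 \<Longrightarrow> L = 0 \<Longrightarrow> \<bar>heaviside c1 * A1 * expo y L w c1 + heaviside c2 * A2 * expo y L w c2\<bar> \<le> d * (X / r)"
  shows "norm (green_normal y L w c1 c2 A1 A2) \<le> (8 + 100 * (d / r)) * X"
proof -
  have Q: "d * (X / r) \<ge> 0" "(8 + 100 * (d / r)) * X = 8 * X + 100 * (d * (X / r))"
    using d X r(1) by (auto simp: algebra_simps)
  have fin: "8 * X + 2 * d * (48 * (X / r)) \<le> (8 + 100 * (d / r)) * X"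
  proof -
    have "2 * d * (48 * (X / r)) = 96 * (d * (X / r))" by simp
    thus ?thesis using Q by linarith
  qed
  consider "y > 0" | "y < 0" "r \<le> L" "w \<ge> 0" | "y < 0" "r \<le> L" "w < 0" | "y < 0" "L = 0"
    using y r by linarith
  then show ?thesis
  proof cases
    case 1
    have "green_normal y L w c1 c2 A1 A2 = of_real (- 1 / (2 * pi)) * (kern0 y L w + of_real A1 * kern y L c1 w + of_real A2 * kern y L c2 w)"
      using 1 by (simp add: green_normal_def heaviside_def)
    also have "norm \<dots> \<le> 8 * X + 2 * d * (48 * (X / r))"
      by (rule norm_lin3_le) (use t pos 1 A in auto)
    finally show ?thesis using fin by linarith
  next
    case 2
    let ?k = "\<lambda>c. kern y L c w - of_real (2 * pi * heaviside c * expo y L w c)"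
    \<comment> \<open>Each residue subtracted from \<open>kern\<close> is exactly one discrete
      term.\<close>
    have "green_normal y L w c1 c2 A1 A2 = of_real (1 / (2 * pi)) * (kern0 y L w + of_real A1 * ?k c1 + of_real A2 * ?k c2)"
      using 2 by (simp add: green_normal_def heaviside_def[of "- y"] field_simps)
    also have "norm \<dots> \<le> 8 * X + 2 * d * (48 * (X / r))"
      by (rule norm_lin3_le) (use t neg 2 A in auto)
    finally show ?thesis using fin by linarith
  next
    case 3
    let ?k = "\<lambda>c. kern y L c w + of_real (2 * pi * (1 - heaviside c) * expo y L w c)"
    \<comment> \<open>Using residues from the other half-plane changes the sum by the two discrete
      terms taken together, and these add up to 0.\<close>
    have "green_normal y L w c1 c2 A1 A2 = of_real (1 / (2 * pi)) * (kern0 y L w + of_real A1 * ?k c1 + of_real A2 * ?k c2)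
        - of_real (A1 * expo y L w c1 + A2 * expo y L w c2)"
      using 3 by (simp add: green_normal_def heaviside_def[of "- y"] field_simps)
    hence "green_normal y L w c1 c2 A1 A2 = of_real (1 / (2 * pi)) * (kern0 y L w + of_real A1 * ?k c1 + of_real A2 * ?k c2)"
      unfolding cancel by simp
    also have "norm \<dots> \<le> 8 * X + 2 * d * (48 * (X / r))"
      by (rule norm_lin3_le) (use t neg' 3 A in auto)
    finally show ?thesis using fin by linarith
  next
    case 4
    \<comment> \<open>For \<open>L = 0\<close> and \<open>y < 0\<close> the cut-off region is empty,
      so only the discrete terms remain.\<close>
    have "env y L = (\<lambda>s. 0)"
      using 4 by (auto simp: env_def heaviside_def zero_less_mult_iff fun_eq_iff)
    hence "green_normal y L w c1 c2 A1 A2 = - of_real (heaviside c1 * A1 * expo y L w c1 + heaviside c2 * A2 * expo y L w c2)"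
      using 4 by (simp add: green_normal_def kern0_def kern_def heaviside_def[of "- y"])
    also have "norm \<dots> \<le> d * (X / r)"
      unfolding norm_minus_cancel norm_of_real by (rule zero) (use 4 in auto)
    also have "\<dots> \<le> (8 + 100 * (d / r)) * X"
      using Q X by linarith
    finally show ?thesis .
  qed
qed

lemma mult_exp_minus_le_one: "t * exp (- t) \<le> (1::real)"
proof -
  have "t \<le> exp t" using exp_ge_add_one_self[of t] by linarith
  thus ?thesis by (simp add: exp_minus divide_simps)
qed

lemma mult_exp_minus_sq_le_one: "t * exp (- t\<^sup>2) \<le> (1::real)"
proof -
  have "2 * t \<le> 1 + t\<^sup>2" using zero_le_power2[of "t - 1"] by (simp add: power2_eq_square algebra_simps)
  hence "t \<le> 1 + t\<^sup>2" using zero_le_power2[of t] by linarith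
  also have "\<dots> \<le> exp (t\<^sup>2)" by (rule exp_ge_add_one_self)
  finally show ?thesis by (simp add: exp_minus divide_simps)
qed

text \<open>\<open>r\<close> bounds from below either \<open>L\<close> or, when
  \<open>L = 0\<close>, the distances to both poles; away from these degenerations the kernels and
  the discrete pair decay in \<open>y\<close> and in \<open>w\<close>.\<close>

lemma green_normal_decay:
  assumes L: "L \<ge> 0" and d: "d \<ge> 0" and r: "r > 0" "r \<le> L \<or> L = 0 \<and> r \<le> \<bar>c1\<bar> \<and> r \<le> \<bar>c2\<bar>" and y: "y \<noteq> 0"
    and c: "c2 < c1" "c1 \<noteq> 0" "c2 \<noteq> 0"
    and A: "\<bar>A1\<bar> \<le> d" "\<bar>A2\<bar> \<le> d" and cancel: "A1 * expo y L w c1 + A2 * expo y L w c2 = 0"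
  shows "norm (green_normal y L w c1 c2 A1 A2) * sqrt \<bar>y\<bar> \<le> 8 + 100 * (d / r)"
    and "norm (green_normal y L w c1 c2 A1 A2) * \<bar>w\<bar> \<le> 8 + 100 * (d / r)"
proof -
  have r': "r \<le> L \<or> L = 0" using r by blast
  have m: "r \<le> sqrt (c\<^sup>2 + L\<^sup>2)" if "c \<in> {c1, c2}" for c
  proof -
    have "\<bar>c\<bar> \<le> sqrt (c\<^sup>2 + L\<^sup>2)" "L \<le> sqrt (c\<^sup>2 + L\<^sup>2)" by (auto intro!: real_le_rsqrt)
    moreover have "r \<le> L \<or> r \<le> \<bar>c\<bar>" using that r by auto
    ultimately show ?thesis by linarith
  qed
  have zero: "\<bar>heaviside c1 * A1 * expo y L w c1 + heaviside c2 * A2 * expo y L w c2\<bar> \<le> d * exp (- (r * \<bar>w\<bar> + r\<^sup>2 * \<bar>y\<bar>))"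
    if "y < 0" "L = 0"
    using that r L by (intro disc_sum_le c A cancel) auto
  have sy: "sqrt \<bar>y\<bar> > 0" using y by simp
  define X where "X = 1 / sqrt \<bar>y\<bar>"
  have X: "X \<ge> 0" by (simp add: X_def)
  have p: "sqrt (pi / \<bar>y\<bar>) \<le> 2 * X" using sqrt_pi_divide_le[of y] by (simp add: X_def)
  have p': "2 * sqrt (pi / \<bar>y\<bar>) / q \<le> 48 * (X / r)" if "r \<le> q" for q
  proof -
    have "2 * sqrt (pi / \<bar>y\<bar>) / q \<le> (48 * X) / r"
      using p X that r(1) by (intro frac_le) auto
    thus ?thesis by simp
  qed
  have "norm (green_normal y L w c1 c2 A1 A2) \<le> (8 + 100 * (d / r)) * X"
  proof (rule green_normal_le_aux[OF d r(1) r' y X A cancel])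
    show "norm (kern0 y L w) \<le> 8 * X" using norm_kern0_le_sqrt[OF L y, of w] p X by linarith
    show "norm (kern y L c w) \<le> 48 * (X / r)" if "y > 0" "c \<in> {c1, c2}" for c
      using norm_kern_le_sqrt[OF L that(1), of c w] p'[OF m[OF that(2)]] that c by auto
    show "norm (kern y L c w - of_real (2 * pi * heaviside c * expo y L w c)) \<le> 48 * (X / r)"
      if "y < 0" "r \<le> L" "w \<ge> 0" "c \<in> {c1, c2}" for c
      using kern_neg_diff(1)[of y L c w] p'[OF that(2)] that c r unfolding expo_def by auto
    show "norm (kern y L c w + of_real (2 * pi * (1 - heaviside c) * expo y L w c)) \<le> 48 * (X / r)"
      if "y < 0" "r \<le> L" "w < 0" "c \<in> {c1, c2}" for c
      using kern_neg_diff'(1)[of y L c w] p'[OF that(2)] that c r unfolding expo_def by auto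
    assume "y < 0" "L = 0"
    note zero[OF this]
    also have "d * exp (- (r * \<bar>w\<bar> + r\<^sup>2 * \<bar>y\<bar>)) \<le> d * (X / r)"
    proof (rule mult_left_mono[OF _ d])
      have "exp (- (r * \<bar>w\<bar> + r\<^sup>2 * \<bar>y\<bar>)) \<le> exp (- (r * sqrt \<bar>y\<bar>)\<^sup>2)"
        using r(1) by (simp add: power_mult_distrib)
      also have "\<dots> \<le> X / r"
        using mult_exp_minus_sq_le_one[of "r * sqrt \<bar>y\<bar>"] r(1) sy by (simp add: X_def field_simps)
      finally show "exp (- (r * \<bar>w\<bar> + r\<^sup>2 * \<bar>y\<bar>)) \<le> X / r" .
    qed
    finally show "\<bar>heaviside c1 * A1 * expo y L w c1 + heaviside c2 * A2 * expo y L w c2\<bar> \<le> d * (X / r)" .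
  qed
  from mult_right_mono[OF this, of "sqrt \<bar>y\<bar>"] show "norm (green_normal y L w c1 c2 A1 A2) * sqrt \<bar>y\<bar> \<le> 8 + 100 * (d / r)"
    using sy by (simp add: X_def)
  show "norm (green_normal y L w c1 c2 A1 A2) * \<bar>w\<bar> \<le> 8 + 100 * (d / r)"
  proof (cases "w = 0")
    case True thus ?thesis using d r(1) by simp
  next
    case w: False
    define X where "X = 1 / \<bar>w\<bar>"
    have X: "X \<ge> 0" by (simp add: X_def)
    have q: "2 / (L * \<bar>w\<bar>) \<le> 48 * (X / r)" if "r \<le> L"
    proof -
      have "2 / (L * \<bar>w\<bar>) \<le> 48 / (r * \<bar>w\<bar>)"
        using that r(1) w by (intro frac_le mult_right_mono) auto
      thus ?thesis by (simp add: X_def mult.commute)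
    qed
    have "norm (green_normal y L w c1 c2 A1 A2) \<le> (8 + 100 * (d / r)) * X"
    proof (rule green_normal_le_aux[OF d r(1) r' y X A cancel])
      show "norm (kern0 y L w) \<le> 8 * X" using norm_kern0_le_inverse[OF L y w] by (simp add: X_def)
      show "norm (kern y L c w) \<le> 48 * (X / r)" if "y > 0" "c \<in> {c1, c2}" for c
      proof -
        have "norm (kern y L c w) \<le> 48 / (sqrt (c\<^sup>2 + L\<^sup>2) * \<bar>w\<bar>)"
          by (rule norm_kern_le_inverse) (use L that c w in auto)
        also have "\<dots> \<le> 48 / (r * \<bar>w\<bar>)"
          using m[OF that(2)] r(1) w by (intro frac_le mult_right_mono) auto
        finally show ?thesis by (simp add: X_def mult.commute)
      qed
      show "norm (kern y L c w - of_real (2 * pi * heaviside c * expo y L w c)) \<le> 48 * (X / r)"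
        if "y < 0" "r \<le> L" "w \<ge> 0" "c \<in> {c1, c2}" for c
        using kern_neg_diff(2)[of y L c w] q[OF that(2)] that c r w unfolding expo_def by auto
      show "norm (kern y L c w + of_real (2 * pi * (1 - heaviside c) * expo y L w c)) \<le> 48 * (X / r)"
        if "y < 0" "r \<le> L" "w < 0" "c \<in> {c1, c2}" for c
        using kern_neg_diff'(2)[of y L c w] q[OF that(2)] that c r unfolding expo_def by auto
      assume "y < 0" "L = 0"
      note zero[OF this]
      also have "d * exp (- (r * \<bar>w\<bar> + r\<^sup>2 * \<bar>y\<bar>)) \<le> d * (X / r)"
      proof (rule mult_left_mono[OF _ d])
        have "exp (- (r * \<bar>w\<bar> + r\<^sup>2 * \<bar>y\<bar>)) \<le> exp (- (r * \<bar>w\<bar>))" by simp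
        also have "\<dots> \<le> X / r"
          using mult_exp_minus_le_one[of "r * \<bar>w\<bar>"] r(1) w by (simp add: X_def field_simps)
        finally show "exp (- (r * \<bar>w\<bar> + r\<^sup>2 * \<bar>y\<bar>)) \<le> X / r" .
      qed
      finally show "\<bar>heaviside c1 * A1 * expo y L w c1 + heaviside c2 * A2 * expo y L w c2\<bar> \<le> d * (X / r)" .
    qed
    from mult_right_mono[OF this, of "\<bar>w\<bar>"] show ?thesis
      using w by (simp add: X_def)
  qed
qed

section \<open>Extension to the singular lines\<close>

lemma tendsto_heaviside:
  assumes "(f \<longlongrightarrow> u) F" "u \<noteq> 0"
  shows "((\<lambda>x. heaviside (f x)) \<longlongrightarrow> heaviside u) F"
proof (rule tendsto_eventually)
  consider "u > 0" | "u < 0" using assms(2) by linarith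
  thus "eventually (\<lambda>x. heaviside (f x) = heaviside u) F"
  proof cases
    case 1
    from order_tendstoD(1)[OF assms(1) this] show ?thesis
      by eventually_elim (use 1 in \<open>simp add: heaviside_def\<close>)
  next
    case 2
    from order_tendstoD(2)[OF assms(1) this] show ?thesis
      by eventually_elim (use 2 in \<open>simp add: heaviside_def\<close>)
  qed
qed

lemma env_tendsto:
  assumes L: "Ls \<longlonglongrightarrow> L" and y: "y \<noteq> 0" and s: "s \<noteq> L" "s \<noteq> - L"
  shows "(\<lambda>n. env y (Ls n) s) \<longlonglongrightarrow> env y L s"
proof -
  have "s\<^sup>2 \<noteq> L\<^sup>2" using s by (simp add: power2_eq_iff)
  hence "(s\<^sup>2 - L\<^sup>2) * y \<noteq> 0" using y by simp
  thus ?thesis unfolding env_def by (intro tendsto_intros tendsto_heaviside L)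
qed

text \<open>One Gaussian dominates for all \<open>L\<close> in \<open>[0, M]\<close>: for
  \<open>y > 0\<close> the exponent increases with \<open>L\<close>, and for \<open>y < 0\<close>
  the support lies in \<open>|s| \<le> M\<close>, where the right-hand side is at least 1.\<close>

lemma env_le_dominating:
  assumes "0 \<le> L" "L \<le> M"
  shows "env y L s \<le> exp (M\<^sup>2 * \<bar>y\<bar>) * exp (- (\<bar>y\<bar> * (s - 0)\<^sup>2))"
proof (cases "(s\<^sup>2 - L\<^sup>2) * y > 0")
  case True
  have LM: "L\<^sup>2 \<le> M\<^sup>2" using assms by (intro power_mono) auto
  have "- ((s\<^sup>2 - L\<^sup>2) * y) \<le> (M\<^sup>2 - s\<^sup>2) * \<bar>y\<bar>"
  proof (cases "y > 0")
    case True
    have "(L\<^sup>2 - s\<^sup>2) * y \<le> (M\<^sup>2 - s\<^sup>2) * y" using LM True by (intro mult_right_mono) auto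
    thus ?thesis using True by (simp add: algebra_simps)
  next
    case False
    hence "s\<^sup>2 \<le> M\<^sup>2" using True LM by (auto simp: zero_less_mult_iff)
    hence "0 \<le> (M\<^sup>2 - s\<^sup>2) * \<bar>y\<bar>" by (intro mult_nonneg_nonneg) auto
    thus ?thesis using True by linarith
  qed
  hence "env y L s \<le> exp ((M\<^sup>2 - s\<^sup>2) * \<bar>y\<bar>)" using True by (simp add: env_def heaviside_def)
  also have "\<dots> = exp (M\<^sup>2 * \<bar>y\<bar>) * exp (- (\<bar>y\<bar> * (s - 0)\<^sup>2))"
    unfolding exp_add[symmetric] by (simp add: algebra_simps)
  finally show ?thesis .
qed (simp add: env_def heaviside_def)

lemma kern0_tendsto:
  assumes L: "Ls \<longlonglongrightarrow> L" "\<And>n. 0 \<le> Ls n" "\<And>n. Ls n \<le> M" and w: "wn \<longlonglongrightarrow> w" and y: "y \<noteq> 0"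
  shows "(\<lambda>n. kern0 y (Ls n) (wn n)) \<longlonglongrightarrow> kern0 y L w"
  unfolding kern0_def
proof (rule integral_dominated_convergence)
  show "integrable lborel (\<lambda>s. exp (M\<^sup>2 * \<bar>y\<bar>) * exp (- (\<bar>y\<bar> * (s - 0)\<^sup>2)))"
    using y by (intro integrable_mult_right gauss_integrable) auto
  show "AE s in lborel. (\<lambda>n. complex_of_real (env y (Ls n) s) * cis (s * wn n)) \<longlonglongrightarrow> complex_of_real (env y L s) * cis (s * w)"
    using AE_lborel_singleton[of L] AE_lborel_singleton[of "- L"]
    by eventually_elim (intro tendsto_intros env_tendsto L w y)
  show "AE s in lborel. norm (complex_of_real (env y (Ls n) s) * cis (s * wn n)) \<le> exp (M\<^sup>2 * \<bar>y\<bar>) * exp (- (\<bar>y\<bar> * (s - 0)\<^sup>2))" for n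
    using env_le_dominating[OF L(2,3)] by (intro AE_I2) (simp add: norm_mult env_nonneg)
qed measurable

text \<open>The limit \<open>c\<close> may be 0. As \<open>y > 0\<close> and
  \<open>Ls n \<ge> r\<close>, the support stays in \<open>|s| > r\<close>, which keeps the
  denominators at least \<open>r\<close> in modulus.\<close>

lemma kern_tendsto:
  assumes L: "Ls \<longlonglongrightarrow> L" "\<And>n. r \<le> Ls n" "\<And>n. Ls n \<le> M" and r: "r > 0"
    and w: "wn \<longlonglongrightarrow> w" and c: "cn \<longlonglongrightarrow> c" and y: "y > 0"
  shows "(\<lambda>n. kern y (Ls n) (cn n) (wn n)) \<longlonglongrightarrow> kern y L c w"
  unfolding kern_def
proof (rule integral_dominated_convergence)
  show "integrable lborel (\<lambda>s. exp (M\<^sup>2 * \<bar>y\<bar>) * exp (- (\<bar>y\<bar> * (s - 0)\<^sup>2)) / r)"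
    using y by (intro integrable_divide integrable_mult_right gauss_integrable) auto
  show "AE s in lborel. (\<lambda>n. complex_of_real (env y (Ls n) s) * cis (s * wn n) / Complex (cn n) s) \<longlonglongrightarrow>
      complex_of_real (env y L s) * cis (s * w) / Complex c s"
    using AE_lborel_singleton[of L] AE_lborel_singleton[of "- L"] AE_lborel_singleton[of 0]
  proof eventually_elim
    case (elim s)
    have "Complex c s \<noteq> 0" using elim by (simp add: complex_eq_iff)
    thus ?case using elim y by (intro tendsto_intros env_tendsto L w c tendsto_Complex) auto
  qed
  show "AE s in lborel. norm (complex_of_real (env y (Ls n) s) * cis (s * wn n) / Complex (cn n) s)
      \<le> exp (M\<^sup>2 * \<bar>y\<bar>) * exp (- (\<bar>y\<bar> * (s - 0)\<^sup>2)) / r" for n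
  proof (rule AE_I2)
    fix s
    have L0: "0 \<le> Ls n" using L(2)[of n] r by linarith
    show "norm (complex_of_real (env y (Ls n) s) * cis (s * wn n) / Complex (cn n) s)
      \<le> exp (M\<^sup>2 * \<bar>y\<bar>) * exp (- (\<bar>y\<bar> * (s - 0)\<^sup>2)) / r"
    proof (cases "env y (Ls n) s = 0")
      case True thus ?thesis using r by simp
    next
      case False
      hence "(s\<^sup>2 - (Ls n)\<^sup>2) * y > 0" by (auto simp: env_def heaviside_def split: if_splits)
      hence "(Ls n)\<^sup>2 < s\<^sup>2" using y by (auto simp: zero_less_mult_iff)
      hence "Ls n \<le> \<bar>s\<bar>" using L0 by (metis abs_of_nonneg abs_le_square_iff less_imp_le)
      also have "\<dots> \<le> norm (Complex (cn n) s)" using abs_Im_le_cmod[of "Complex (cn n) s"] by simp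
      finally have "r \<le> norm (Complex (cn n) s)" using L(2)[of n] by linarith
      hence "env y (Ls n) s / norm (Complex (cn n) s) \<le> exp (M\<^sup>2 * \<bar>y\<bar>) * exp (- (\<bar>y\<bar> * (s - 0)\<^sup>2)) / r"
        using env_le_dominating[OF L0 L(3), of y s] r env_nonneg[of y "Ls n" s] by (intro frac_le) auto
      thus ?thesis by (simp add: norm_mult norm_divide env_nonneg)
    qed
  qed
qed measurable

text \<open>The half-lines stay at distance at least \<open>r\<close> from the imaginary axis, where
  the poles lie, so \<open>c\<close> may cross 0; the lower bound \<open>W\<close> supplies one
  dominating function.\<close>

lemma side_tendsto:
  assumes L: "Ls \<longlonglongrightarrow> L" "\<And>n. r \<le> Ls n" and r: "r > 0"
    and w: "wn \<longlonglongrightarrow> w" "\<And>n. W \<le> wn n" and c: "cn \<longlonglongrightarrow> c" and b: "b > 0"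
  shows "(\<lambda>n. \<integral>t. indicator {0..} t *\<^sub>R side b (Ls n) (cn n) (wn n) t \<partial>lborel) \<longlonglongrightarrow>
     (\<integral>t. indicator {0..} t *\<^sub>R side b L c w t \<partial>lborel)"
proof (rule integral_dominated_convergence)
  show "integrable lborel (\<lambda>t. exp (- (t * W + t\<^sup>2 * b)) / r)"
    using exp_quad_integrable[OF b] by (rule integrable_divide)
  have "L \<ge> r" using L by (intro LIMSEQ_le_const) auto
  hence "Complex L (t - c) \<noteq> 0" for t using r by (simp add: complex_eq_iff)
  thus "AE t in lborel. (\<lambda>n. indicator {0..} t *\<^sub>R side b (Ls n) (cn n) (wn n) t) \<longlonglongrightarrow> indicator {0..} t *\<^sub>R side b L c w t"
    unfolding side_def by (intro AE_I2 tendsto_intros tendsto_Complex tendsto_Re L w c) auto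
  show "AE t in lborel. norm (indicator {0..} t *\<^sub>R side b (Ls n) (cn n) (wn n) t) \<le> exp (- (t * W + t\<^sup>2 * b)) / r" for n
  proof (rule AE_I2)
    fix t :: real
    have "\<bar>side b (Ls n) (cn n) (wn n) t\<bar> \<le> exp (- (t * W + t\<^sup>2 * b)) / r" if "t \<ge> 0"
    proof -
      have "\<bar>side b (Ls n) (cn n) (wn n) t\<bar> \<le> exp (- (t * wn n + t\<^sup>2 * b)) / Ls n"
        using L(2)[of n] r by (intro abs_side_le) linarith
      also have "\<dots> \<le> exp (- (t * W + t\<^sup>2 * b)) / r"
        using L(2)[of n] r w(2)[of n] that by (intro frac_le) (auto intro: mult_left_mono)
      finally show ?thesis .
    qed
    thus "norm (indicator {0..} t *\<^sub>R side b (Ls n) (cn n) (wn n) t) \<le> exp (- (t * W + t\<^sup>2 * b)) / r"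
      using r by (auto simp: indicator_def)
  qed
qed measurable

lemma green_normal_pos:
  assumes "y > 0"
  shows "green_normal y L w c1 c2 A1 A2 = - of_real (1 / (2 * pi)) * (kern0 y L w + of_real A1 * kern y L c1 w + of_real A2 * kern y L c2 w)"
  using assms by (simp add: green_normal_def heaviside_def)

text \<open>Rotation produces residues that cancel the discrete terms, and the resulting expression
  has no jump as \<open>c1\<close> or \<open>c2\<close> passes through 0.\<close>

lemma green_normal_neg:
  assumes "y < 0" "L > 0" "c1 \<noteq> 0" "c2 \<noteq> 0"
  shows "green_normal y L w c1 c2 A1 A2 = of_real (1 / (2 * pi)) * (kern0 y L w
      - of_real (2 * A1 * (\<integral>t. indicator {0..} t *\<^sub>R side (- y) L c1 w t \<partial>lborel))
      - of_real (2 * A2 * (\<integral>t. indicator {0..} t *\<^sub>R side (- y) L c2 w t \<partial>lborel)))"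
  using assms unfolding green_normal_def
  by (simp add: kern_rotate heaviside_def[of "- y"] expo_def field_simps)

section \<open>The Green function on and across the singular lines\<close>

context
  fixes k1 k2 a :: real
  assumes a: "a > 0" and k: "k1 \<noteq> 0" "k2 \<noteq> 0" "k1 < k2"
begin

abbreviation "regular \<equiv> {m. Re m \<noteq> k1 \<and> Re m \<noteq> k2}"

lemma shear_tendsto [tendsto_intros]:
  "(f \<longlongrightarrow> l) F \<Longrightarrow> ((\<lambda>n. shear x x' (f n)) \<longlongrightarrow> shear x x' l) F"
  unfolding shear_def by (intro tendsto_intros)

text \<open>The limit is explicit: the normal form for \<open>y > 0\<close> and its rotated version
  for \<open>y < 0\<close> remain meaningful on the singular lines as long as
  \<open>Im l \<noteq> 0\<close>.\<close>

lemma green_formula_convergent: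
  assumes l: "Im l \<noteq> 0"
  obtains g where "(green_formula k1 k2 a x x' \<longlongrightarrow> g) (at l within regular)"
proof (cases "snd x = snd x'")
  case True
  hence "green_formula k1 k2 a x x' = (\<lambda>l. 0)" by (simp add: fun_eq_iff green_formula_same_time[OF a])
  thus ?thesis by (intro that[of 0]) simp
next
  case False
  define y where "y = snd x - snd x'"
  have y: "y \<noteq> 0" using False by (simp add: y_def)
  \<comment> \<open>Within distance \<open>r\<close> of \<open>l\<close> the modulus of the
    imaginary part stays between \<open>r\<close> and \<open>3 * r\<close>.\<close>
  define r where "r = \<bar>Im l\<bar> / 2"
  have r: "r > 0" using l by (simp add: r_def)
  define A1 A2 where "A1 = coef1 k1 k2 a x x'" "A2 = coef2 k1 k2 a x x'"
  define w where "w = shear x x'"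
  define S where "S c = (\<integral>t. indicator {0..} t *\<^sub>R side (- y) \<bar>Im l\<bar> c (w l) t \<partial>lborel)" for c
  define H where "H = (if y > 0 then - of_real (1 / (2 * pi)) * (kern0 y \<bar>Im l\<bar> (w l) + of_real A1 * kern y \<bar>Im l\<bar> (Re l - k1) (w l) + of_real A2 * kern y \<bar>Im l\<bar> (Re l - k2) (w l))
     else of_real (1 / (2 * pi)) * (kern0 y \<bar>Im l\<bar> (w l) - of_real (2 * A1 * S (Re l - k1)) - of_real (2 * A2 * S (Re l - k2))))"
  have at: "at l within regular = at l within (regular \<inter> ball l r)"
    by (rule at_within_nhd[of _ "ball l r"]) (use r in auto)
  have "(green_formula k1 k2 a x x' \<longlongrightarrow> cis (- (Im l * w l)) * H) (at l within (regular \<inter> ball l r))"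
    unfolding tendsto_at_iff_sequentially o_def
  proof (intro allI impI)
    fix X assume X: "\<forall>i. X i \<in> regular \<inter> ball l r - {l}" and lim: "X \<longlonglongrightarrow> l"
    have reg: "Re (X i) \<noteq> k1" "Re (X i) \<noteq> k2" for i using X by auto
    have d: "norm (X i - l) < r" for i using X by (auto simp: dist_norm norm_minus_commute)
    have ImX: "\<bar>Im (X i) - Im l\<bar> < r" "\<bar>Re (X i) - Re l\<bar> < r" for i
      using d[of i] abs_Im_le_cmod[of "X i - l"] abs_Re_le_cmod[of "X i - l"] by auto
    have L: "(\<lambda>i. \<bar>Im (X i)\<bar>) \<longlonglongrightarrow> \<bar>Im l\<bar>" by (intro tendsto_intros lim)
    have Lr: "r \<le> \<bar>Im (X i)\<bar>" "\<bar>Im (X i)\<bar> \<le> 3 * r" "0 \<le> \<bar>Im (X i)\<bar>" "0 < \<bar>Im (X i)\<bar>" for i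
      using ImX(1)[of i] r_def r by linarith+
    have wl: "(\<lambda>i. w (X i)) \<longlonglongrightarrow> w l" unfolding w_def by (intro tendsto_intros lim)
    then obtain W where W: "\<And>i. \<bar>w (X i)\<bar> \<le> W"
      using convergent_imp_Bseq[of "\<lambda>i. w (X i)"] unfolding convergent_def Bseq_def by auto
    have Wl: "- W \<le> w (X i)" for i using W[of i] by linarith
    have c: "(\<lambda>i. Re (X i) - k) \<longlonglongrightarrow> Re l - k" for k by (intro tendsto_intros lim)
    have eq: "green_formula k1 k2 a x x' (X i) = cis (- (Im (X i) * w (X i))) *
       green_normal y \<bar>Im (X i)\<bar> (w (X i)) (Re (X i) - k1) (Re (X i) - k2) A1 A2" for i
      unfolding y_def w_def A1_A2_def
      by (rule green_formula_eq_normal[OF a]) (use k reg False in auto)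
    have "(\<lambda>i. green_normal y \<bar>Im (X i)\<bar> (w (X i)) (Re (X i) - k1) (Re (X i) - k2) A1 A2) \<longlonglongrightarrow> H"
    proof (cases "y > 0")
      case True
      show ?thesis unfolding green_normal_pos[OF True] H_def using True
        by (simp only: if_True, intro tendsto_intros kern0_tendsto[OF L Lr(3,2)] kern_tendsto[OF L Lr(1,2)] wl c r y)
    next
      case False
      hence y': "y < 0" using y by linarith
      have n: "green_normal y \<bar>Im (X i)\<bar> (w (X i)) (Re (X i) - k1) (Re (X i) - k2) A1 A2 =
        of_real (1 / (2 * pi)) * (kern0 y \<bar>Im (X i)\<bar> (w (X i))
      - of_real (2 * A1 * (\<integral>t. indicator {0..} t *\<^sub>R side (- y) \<bar>Im (X i)\<bar> (Re (X i) - k1) (w (X i)) t \<partial>lborel))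
      - of_real (2 * A2 * (\<integral>t. indicator {0..} t *\<^sub>R side (- y) \<bar>Im (X i)\<bar> (Re (X i) - k2) (w (X i)) t \<partial>lborel)))" for i
        by (rule green_normal_neg[OF y']) (use Lr(4)[of i] reg[of i] in auto)
      have y'': "- y > 0" using y' by simp
      show ?thesis unfolding n H_def S_def using False
        by (simp only: if_False, intro tendsto_intros kern0_tendsto[OF L Lr(3,2) wl y] side_tendsto[OF L Lr(1) r wl Wl c y''])
    qed
    thus "(\<lambda>i. green_formula k1 k2 a x x' (X i)) \<longlonglongrightarrow> cis (- (Im l * w l)) * H"
      unfolding eq by (intro tendsto_intros lim wl)
  qed
  thus ?thesis unfolding at[symmetric] by (rule that)
qed

lemma regular_approx:
  assumes "l \<notin> regular"
  obtains X where "\<And>n. X n \<in> regular - {l}" "X \<longlonglongrightarrow> l"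
proof -
  \<comment> \<open>The shift \<open>n + 2\<close> keeps \<open>t n\<close> strictly below
    \<open>k2 - k1\<close>, so horizontal translates from the line of \<open>k1\<close> never reach
    that of \<open>k2\<close>.\<close>
  define t where "t n = (k2 - k1) / real (n + 2)" for n
  define X where "X n = l + of_real (t n)" for n
  have t: "0 < t n" "t n < k2 - k1" for n
    using k divide_strict_left_mono[of 1 "real (n + 2)" "k2 - k1"] by (auto simp: t_def)
  have "X n \<in> regular - {l}" for n
    using t[of n] assms k by (auto simp: X_def complex_eq_iff)
  moreover have "t \<longlonglongrightarrow> 0"
    unfolding t_def by real_asymp
  hence "X \<longlonglongrightarrow> l + of_real 0" unfolding X_def by (intro tendsto_intros)
  ultimately show ?thesis using that by auto
qed

text \<open>\<open>Lim\<close> yields the limit only if one exists and the filter is nontrivial; off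
  the poles a point of a singular line has \<open>Im l \<noteq> 0\<close>, which gives the
  former.\<close>

lemma green_tendsto:
  assumes l: "l \<noteq> of_real k1" "l \<noteq> of_real k2" "l \<notin> regular"
  shows "(green_formula k1 k2 a x x' \<longlongrightarrow> green k1 k2 a x x' l) (at l within regular)"
proof -
  have "Im l \<noteq> 0" using l by (auto simp: complex_eq_iff)
  then obtain g where g: "(green_formula k1 k2 a x x' \<longlongrightarrow> g) (at l within regular)"
    using green_formula_convergent by blast
  have "at l within regular \<noteq> bot"
  proof -
    obtain X where "\<And>n. X n \<in> regular - {l}" "X \<longlonglongrightarrow> l" using regular_approx[OF l(3)] by blast
    hence "l islimpt regular" unfolding islimpt_sequential by blast
    thus ?thesis by (simp add: trivial_limit_within)
  qed
  with g have "Lim (at l within regular) (green_formula k1 k2 a x x') = g" by (intro tendsto_Lim)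
  moreover have "green k1 k2 a x x' l = Lim (at l within regular) (green_formula k1 k2 a x x')"
    using l(3) by (auto simp: green_def)
  ultimately show ?thesis using g by simp
qed

text \<open>The constant off the lines does not depend on \<open>l\<close>, so the bound passes to
  the limit on the lines.\<close>

lemma green_bounded:
  obtains C where "\<And>x x' l. snd x \<noteq> snd x' \<Longrightarrow> l \<noteq> of_real k1 \<Longrightarrow> l \<noteq> of_real k2 \<Longrightarrow>
     norm (green k1 k2 a x x' l) \<le> C * (1 + 1 / sqrt \<bar>snd x - snd x'\<bar>)"
proof -
  have "k2 - k1 \<ge> 0" using k by simp
  then obtain C where C: "\<And>y L w c1 c2 A1 A2. y \<noteq> 0 \<Longrightarrow> L \<ge> 0 \<Longrightarrow> c2 < c1 \<Longrightarrow> c1 \<noteq> 0 \<Longrightarrow> c2 \<noteq> 0 \<Longrightarrow>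
      \<bar>A1\<bar> \<le> k2 - k1 \<Longrightarrow> \<bar>A2\<bar> \<le> k2 - k1 \<Longrightarrow> A1 * expo y L w c1 + A2 * expo y L w c2 = 0 \<Longrightarrow>
      norm (green_normal y L w c1 c2 A1 A2) \<le> C * (1 + 1 / sqrt \<bar>y\<bar>)"
    by (rule green_normal_bounded) (rule that; assumption)
  have f: "norm (green_formula k1 k2 a x x' l) \<le> C * (1 + 1 / sqrt \<bar>snd x - snd x'\<bar>)"
    if "snd x \<noteq> snd x'" "l \<in> regular" for x x' l
  proof -
    have eq: "norm (green_formula k1 k2 a x x' l) = norm (green_normal (snd x - snd x') \<bar>Im l\<bar> (shear x x' l) (Re l - k1) (Re l - k2) (coef1 k1 k2 a x x') (coef2 k1 k2 a x x'))"
      by (subst green_formula_eq_normal[OF a]) (use that k in \<open>auto simp: norm_mult\<close>)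
    show ?thesis unfolding eq
      by (rule C) (use that k abs_coef_le[OF a k(3), of x x'] coef_cancel[OF a] in auto)
  qed
  show ?thesis
  proof (rule that)
    fix x x' :: "real \<times> real" and l assume x: "snd x \<noteq> snd x'" and l: "l \<noteq> complex_of_real k1" "l \<noteq> complex_of_real k2"
    show "norm (green k1 k2 a x x' l) \<le> C * (1 + 1 / sqrt \<bar>snd x - snd x'\<bar>)"
    proof (cases "l \<in> regular")
      case True thus ?thesis using f[OF x True] by (simp add: green_def)
    next
      case False
      obtain X where X: "\<And>n. X n \<in> regular - {l}" "X \<longlonglongrightarrow> l" using regular_approx[OF False] by blast
      have "(\<lambda>n. green_formula k1 k2 a x x' (X n)) \<longlonglongrightarrow> green k1 k2 a x x' l"
        using green_tendsto[OF l False, of x x'] X unfolding tendsto_at_iff_sequentially o_def by blast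
      thus ?thesis
        by (intro LIMSEQ_le_const2[OF tendsto_norm]) (use f[OF x] X in auto)
    qed
  qed
qed

lemma green_decay:
  assumes l: "l \<noteq> of_real k1" "l \<noteq> of_real k2"
  obtains K where "\<And>x x'. snd x \<noteq> snd x' \<Longrightarrow> norm (green k1 k2 a x x' l) * sqrt \<bar>snd x - snd x'\<bar> \<le> K"
    and "\<And>x x'. snd x \<noteq> snd x' \<Longrightarrow> norm (green k1 k2 a x x' l) * \<bar>shear x x' l\<bar> \<le> K"
proof -
  have f: "norm (green_formula k1 k2 a x x' m) * sqrt \<bar>snd x - snd x'\<bar> \<le> 8 + 100 * ((k2 - k1) / r)"
      "norm (green_formula k1 k2 a x x' m) * \<bar>shear x x' m\<bar> \<le> 8 + 100 * ((k2 - k1) / r)"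
    if "snd x \<noteq> snd x'" "m \<in> regular" "r > 0" "r \<le> \<bar>Im m\<bar> \<or> \<bar>Im m\<bar> = 0 \<and> r \<le> \<bar>Re m - k1\<bar> \<and> r \<le> \<bar>Re m - k2\<bar>" for x x' m r
  proof -
    have eq: "norm (green_formula k1 k2 a x x' m) = norm (green_normal (snd x - snd x') \<bar>Im m\<bar> (shear x x' m) (Re m - k1) (Re m - k2) (coef1 k1 k2 a x x') (coef2 k1 k2 a x x'))"
      by (subst green_formula_eq_normal[OF a]) (use that k in \<open>auto simp: norm_mult\<close>)
    show "norm (green_formula k1 k2 a x x' m) * sqrt \<bar>snd x - snd x'\<bar> \<le> 8 + 100 * ((k2 - k1) / r)"
      "norm (green_formula k1 k2 a x x' m) * \<bar>shear x x' m\<bar> \<le> 8 + 100 * ((k2 - k1) / r)"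
      unfolding eq using that k abs_coef_le[OF a k(3), of x x']
      by (intro green_normal_decay coef_cancel[OF a]; auto)+
  qed
  show ?thesis
  proof (cases "l \<in> regular")
    case True
    define r where "r = (if Im l = 0 then min \<bar>Re l - k1\<bar> \<bar>Re l - k2\<bar> else \<bar>Im l\<bar>)"
    have r: "r > 0" "r \<le> \<bar>Im l\<bar> \<or> \<bar>Im l\<bar> = 0 \<and> r \<le> \<bar>Re l - k1\<bar> \<and> r \<le> \<bar>Re l - k2\<bar>"
      using True by (auto simp: r_def)
    have "green k1 k2 a x x' l = green_formula k1 k2 a x x' l" for x x' using True by (simp add: green_def)
    note g = this
    show ?thesis
    proof (rule that)
      fix x x' :: "real \<times> real" assume x: "snd x \<noteq> snd x'"
      show "norm (green k1 k2 a x x' l) * sqrt \<bar>snd x - snd x'\<bar> \<le> 8 + 100 * ((k2 - k1) / r)"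
        unfolding g by (rule f(1)[OF x True r])
      show "norm (green k1 k2 a x x' l) * \<bar>shear x x' l\<bar> \<le> 8 + 100 * ((k2 - k1) / r)"
        unfolding g by (rule f(2)[OF x True r])
    qed
  next
    case False
    \<comment> \<open>Half of \<open>|Im l|\<close> is eventually exceeded by all approximants, so
      one constant holds along the whole tail.\<close>
    define r where "r = \<bar>Im l\<bar> / 2"
    have r: "r > 0" using l False by (auto simp: r_def complex_eq_iff)
    obtain X where X: "\<And>n. X n \<in> regular - {l}" "X \<longlonglongrightarrow> l" using regular_approx[OF False] by blast
    have g: "(\<lambda>n. green_formula k1 k2 a x x' (X n)) \<longlonglongrightarrow> green k1 k2 a x x' l" for x x'
      using green_tendsto[OF l False, of x x'] X unfolding tendsto_at_iff_sequentially o_def by blast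
    have "(\<lambda>n. \<bar>Im (X n)\<bar>) \<longlonglongrightarrow> \<bar>Im l\<bar>" by (intro tendsto_intros X)
    moreover have "r < \<bar>Im l\<bar>" using r by (simp add: r_def)
    ultimately have ev: "eventually (\<lambda>n. r < \<bar>Im (X n)\<bar>) sequentially" by (rule order_tendstoD)
    have "norm (green k1 k2 a x x' l) * sqrt \<bar>snd x - snd x'\<bar> \<le> 8 + 100 * ((k2 - k1) / r)" if x: "snd x \<noteq> snd x'" for x x'
    proof (rule tendsto_upperbound)
      show "(\<lambda>n. norm (green_formula k1 k2 a x x' (X n)) * sqrt \<bar>snd x - snd x'\<bar>) \<longlonglongrightarrow> norm (green k1 k2 a x x' l) * sqrt \<bar>snd x - snd x'\<bar>"
        by (intro tendsto_intros g)
      show "eventually (\<lambda>n. norm (green_formula k1 k2 a x x' (X n)) * sqrt \<bar>snd x - snd x'\<bar> \<le> 8 + 100 * ((k2 - k1) / r)) sequentially"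
        using ev by eventually_elim (use f(1)[OF x] X(1) r in auto)
    qed simp
    moreover have "norm (green k1 k2 a x x' l) * \<bar>shear x x' l\<bar> \<le> 8 + 100 * ((k2 - k1) / r)" if x: "snd x \<noteq> snd x'" for x x'
    proof (rule tendsto_upperbound)
      show "(\<lambda>n. norm (green_formula k1 k2 a x x' (X n)) * \<bar>shear x x' (X n)\<bar>) \<longlonglongrightarrow> norm (green k1 k2 a x x' l) * \<bar>shear x x' l\<bar>"
        by (intro tendsto_intros g X)
      show "eventually (\<lambda>n. norm (green_formula k1 k2 a x x' (X n)) * \<bar>shear x x' (X n)\<bar> \<le> 8 + 100 * ((k2 - k1) / r)) sequentially"
        using ev by eventually_elim (use f(2)[OF x] X(1) r in auto)
    qed simp
    ultimately show ?thesis using that by blast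
  qed
qed

lemma green_same_time:
  assumes l: "l \<noteq> of_real k1" "l \<noteq> of_real k2" and x: "snd x = snd x'"
  shows "green k1 k2 a x x' l = 0"
proof (cases "l \<in> regular")
  case True thus ?thesis using green_formula_same_time[OF a x] by (simp add: green_def)
next
  case False
  obtain X where X: "\<And>n. X n \<in> regular - {l}" "X \<longlonglongrightarrow> l" using regular_approx[OF False] by blast
  have "(\<lambda>n. green_formula k1 k2 a x x' (X n)) \<longlonglongrightarrow> green k1 k2 a x x' l"
    using green_tendsto[OF l False, of x x'] X unfolding tendsto_at_iff_sequentially o_def by blast
  thus ?thesis using green_formula_same_time[OF a x] by (simp add: LIMSEQ_const_iff)
qed

section \<open>Measurability in the second argument\<close>

lemma green_formula_measurable:
  "(\<lambda>x'. green_formula k1 k2 a x x' l) \<in> borel_measurable borel"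
proof -
  have [measurable]: "(fst :: real \<times> real \<Rightarrow> real) \<in> borel_measurable borel" "(snd :: real \<times> real \<Rightarrow> real) \<in> borel_measurable borel"
    by (intro borel_measurable_continuous_onI continuous_intros)+
  have k12: "k1 \<noteq> k2" using k by simp
  have "(\<lambda>x'. green_cont k1 k2 a x x' l) \<in> borel_measurable borel"
    unfolding green_cont_def sato_phi_def sato_psi_def sato_chi_def sato_xi_def theta_phase_def by measurable
  moreover have "(\<lambda>x'. green_disc k1 k2 a x x' l) \<in> borel_measurable borel"
    unfolding green_disc_def psi_res_eq[OF a k(1,2) k12] wt_def theta_phase_def by measurable
  ultimately show ?thesis unfolding green_formula_def by measurable
qed

text \<open>On a singular line the approximating sequence is chosen independently of
  \<open>x'\<close>, so the map is a pointwise limit of measurable functions.\<close>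

lemma green_measurable:
  assumes l: "l \<noteq> of_real k1" "l \<noteq> of_real k2"
  shows "(\<lambda>x'. green k1 k2 a x x' l) \<in> borel_measurable borel"
proof (cases "l \<in> regular")
  case True thus ?thesis using green_formula_measurable by (simp add: green_def)
next
  case False
  obtain X where X: "\<And>n. X n \<in> regular - {l}" "X \<longlonglongrightarrow> l" using regular_approx[OF False] by blast
  show ?thesis
  proof (rule borel_measurable_LIMSEQ_metric)
    show "(\<lambda>x'. green_formula k1 k2 a x x' (X n)) \<in> borel_measurable borel" for n by (rule green_formula_measurable)
    show "(\<lambda>n. green_formula k1 k2 a x x' (X n)) \<longlonglongrightarrow> green k1 k2 a x x' l" for x'
      using green_tendsto[OF l False, of x x'] X unfolding tendsto_at_iff_sequentially o_def by blast
  qed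
qed

end

section \<open>Convolution\<close>

lemma integrable_lborel_prod_mult:
  fixes u v :: "real \<Rightarrow> real"
  assumes u: "integrable lborel u" and v: "integrable lborel v"
  shows "integrable lborel (\<lambda>p. u (fst p) * v (snd p))"
    and "(\<integral>p. u (fst p) * v (snd p) \<partial>lborel) = (\<integral>s. u s \<partial>lborel) * (\<integral>t. v t \<partial>lborel)"
proof -
  have [measurable]: "u \<in> borel_measurable borel" "v \<in> borel_measurable borel"
    using u v by (simp_all add: borel_measurable_integrable)
  have i: "integrable (lborel \<Otimes>\<^sub>M lborel) (\<lambda>(s, t). u s * v t)"
  proof (rule lborel_pair.Fubini_integrable)
    show "integrable lborel (\<lambda>s. \<integral>t. norm (case (s, t) of (s, t) \<Rightarrow> u s * v t) \<partial>lborel)"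
      using u by (simp add: abs_mult)
    show "AE s in lborel. integrable lborel (\<lambda>t. case (s, t) of (s, t) \<Rightarrow> u s * v t)"
      using v by simp
  qed measurable
  show "integrable lborel (\<lambda>p. u (fst p) * v (snd p))"
    using i unfolding lborel_prod case_prod_beta .
  show "(\<integral>p. u (fst p) * v (snd p) \<partial>lborel) = (\<integral>s. u s \<partial>lborel) * (\<integral>t. v t \<partial>lborel)"
    using lborel_pair.integral_fst[OF i] unfolding lborel_prod case_prod_beta by simp
qed

lemma integrable_inverse_sqrt:
  assumes R: "R \<ge> 0"
  shows "integrable lborel (\<lambda>t. indicator {-R..R} t * (1 / sqrt \<bar>t\<bar>))"
proof -
  \<comment> \<open>Since \<open>sqrt\<close> is odd on the reals, \<open>2 * sqrt t\<close> is a
    continuous antiderivative on both sides of the exceptional point 0.\<close>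
  have "((\<lambda>t. 1 / sqrt \<bar>t\<bar>) has_integral (2 * sqrt R - 2 * sqrt (- R))) {-R..R}"
  proof (rule fundamental_theorem_of_calculus_interior_strong[of "{0}"])
    fix t assume "t \<in> {-R<..<R} - {0}"
    hence t: "t \<noteq> 0" by simp
    have "((\<lambda>t. 2 * sqrt t) has_real_derivative 2 * (if t > 0 then inverse (sqrt t) / 2 else - inverse (sqrt t) / 2)) (at t)"
      by (intro DERIV_cmult DERIV_real_sqrt_generic) (use t in auto)
    moreover have "2 * (if t > 0 then inverse (sqrt t) / 2 else - inverse (sqrt t) / 2) = 1 / sqrt \<bar>t\<bar>"
      using t by (auto simp: abs_if real_sqrt_minus inverse_eq_divide)
    ultimately show "((\<lambda>t. 2 * sqrt t) has_vector_derivative 1 / sqrt \<bar>t\<bar>) (at t)"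
      by (simp add: has_real_derivative_iff_has_vector_derivative)
  qed (use R in \<open>auto intro!: continuous_intros\<close>)
  hence "((\<lambda>t. if t \<in> {-R..R} then 1 / sqrt \<bar>t\<bar> else 0) has_integral (2 * sqrt R - 2 * sqrt (- R))) UNIV"
    by (simp only: has_integral_restrict_UNIV)
  moreover have "(\<lambda>t. if t \<in> {-R..R} then 1 / sqrt \<bar>t\<bar> else 0) = (\<lambda>t. indicator {-R..R} t * (1 / sqrt \<bar>t\<bar>))"
    by auto
  ultimately have "((\<lambda>t. indicator {-R..R} t * (1 / sqrt \<bar>t\<bar>)) has_integral (2 * sqrt R - 2 * sqrt (- R))) UNIV"
    by (simp only:)
  from nn_integral_has_integral_lborel[OF _ _ this]
  have "(\<integral>\<^sup>+t. ennreal (indicator {-R..R} t * (1 / sqrt \<bar>t\<bar>)) \<partial>lborel) = ennreal (2 * sqrt R - 2 * sqrt (- R))"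
    by simp
  thus ?thesis
    by (intro integrableI_nn_integral_finite) (auto simp: indicator_def)
qed

lemma integrable_reflect_shift:
  fixes u :: "real \<Rightarrow> real" and x :: real
  assumes "integrable lborel u"
  shows "integrable lborel (\<lambda>t. u (x - t))" "(\<integral>t. u (x - t) \<partial>lborel) = (\<integral>t. u t \<partial>lborel)"
  using lborel_integrable_real_affine[OF assms, of "-1" x] lborel_integral_real_affine[of "-1" u x] by auto

text \<open>Outside a box of differences \<open>x - x'\<close> the kernel is small and
  \<open>f\<close> is integrable; inside the box the kernel is integrable and, for large
  \<open>x\<close>, the values of \<open>f\<close> are small.\<close>

lemma weak_singular_convolution:
  fixes G :: "real \<times> real \<Rightarrow> real \<times> real \<Rightarrow> complex" and f :: "real \<times> real \<Rightarrow> complex"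
  assumes meas: "\<And>x. G x \<in> borel_measurable borel"
    and diag: "\<And>x x'. snd x = snd x' \<Longrightarrow> G x x' = 0"
    and b1: "\<And>x x'. norm (G x x') * sqrt \<bar>snd x - snd x'\<bar> \<le> K"
    and b2: "\<And>x x'. norm (G x x') * \<bar>fst x - fst x' + q * (snd x - snd x')\<bar> \<le> K"
    and f: "integrable lborel f" "(f \<longlongrightarrow> 0) at_infinity" "\<And>x. norm (f x) \<le> F"
  shows "integrable lborel (\<lambda>x'. G x x' * f x')"
    and "((\<lambda>x. \<integral>x'. G x x' * f x' \<partial>lborel) \<longlongrightarrow> 0) at_infinity"
proof -
  have K: "K \<ge> 0" using b1[of 0 0] by simp
  have F: "F \<ge> 0" using f(3) norm_ge_zero order_trans by blast
  have [measurable]: "f \<in> borel_measurable borel" using f(1) by (simp add: borel_measurable_integrable)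
  note [measurable] = meas
  define u2 where "u2 R t = indicator {-R..R} t * (1 / sqrt \<bar>t\<bar>)" for R t :: real
  define D where "D R x x' = indicator {-R..R} (fst x - fst x') * u2 R (snd x - snd x')" for R :: real and x x' :: "real \<times> real"
  have D0: "D R x x' \<ge> 0" for R x x' by (simp add: D_def u2_def)
  define I where "I R = (\<integral>t. indicator {-R..R} t \<partial>lborel) * (\<integral>t. u2 R t \<partial>lborel)" for R :: real
  have Di: "integrable lborel (D R x)" "(\<integral>x'. D R x x' \<partial>lborel) = I R" if "R \<ge> 0" for R x
  proof -
    have i1: "integrable lborel (indicator {-R..R} :: real \<Rightarrow> real)"
      by (simp add: integrable_indicator_iff emeasure_lborel_Icc_eq)
    have i2: "integrable lborel (u2 R)" unfolding u2_def[abs_def] by (rule integrable_inverse_sqrt[OF that])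
    note j = integrable_reflect_shift[OF i1, of "fst x"] integrable_reflect_shift[OF i2, of "snd x"]
    show "integrable lborel (D R x)" unfolding D_def[abs_def] by (rule integrable_lborel_prod_mult(1)[OF j(1,3)])
    show "(\<integral>x'. D R x x' \<partial>lborel) = I R"
      unfolding D_def I_def integrable_lborel_prod_mult(2)[OF j(1,3)] j ..
  qed
  have key: "\<exists>R\<ge>0. \<forall>x x' b. (\<bar>fst x - fst x'\<bar> \<le> R \<longrightarrow> \<bar>snd x - snd x'\<bar> \<le> R \<longrightarrow> norm (f x') \<le> b) \<longrightarrow> 0 \<le> b \<longrightarrow>
      norm (G x x' * f x') \<le> e * norm (f x') + K * b * D R x x'" if e: "e > 0" for e
  proof -
    \<comment> \<open>If \<open>|G x x'| > e\<close>, the two decay bounds force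
      \<open>sqrt |y| \<le> W\<close> and \<open>|z + q * y| \<le> W\<close>, hence
      \<open>|y| \<le> N\<close> and \<open>|z| \<le> W + |q| * N\<close>.\<close>
    define W where "W = K / e"
    define N where "N = W\<^sup>2"
    define R where "R = max N (W + \<bar>q\<bar> * N)"
    have W: "W \<ge> 0" using K e by (simp add: W_def)
    have N: "sqrt N = W" "N \<ge> 0" using W by (auto simp: N_def)
    have R: "R \<ge> 0" using N by (simp add: R_def)
    have "norm (G x x' * f x') \<le> e * norm (f x') + K * b * D R x x'"
      if b: "\<bar>fst x - fst x'\<bar> \<le> R \<longrightarrow> \<bar>snd x - snd x'\<bar> \<le> R \<longrightarrow> norm (f x') \<le> b" "0 \<le> b" for x x' b
    proof (cases "norm (G x x') \<le> e")
      case True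
      hence "norm (G x x' * f x') \<le> e * norm (f x')" unfolding norm_mult by (intro mult_right_mono) auto
      thus ?thesis using K b(2) D0[of R x x'] by (simp add: add_increasing2)
    next
      case False
      hence Ge: "norm (G x x') > e" by simp
      define y where "y = snd x - snd x'"
      define z where "z = fst x - fst x'"
      have small: "t < W \<or> t = 0" if "norm (G x x') * t \<le> K" "t \<ge> 0" for t
      proof (rule ccontr)
        assume n: "\<not> (t < W \<or> t = 0)"
        hence "t > 0" "t \<ge> W" using that by auto
        hence "K \<le> e * t" using e by (simp add: W_def field_simps)
        also have "e * t < norm (G x x') * t" using Ge \<open>t > 0\<close> by simp
        finally show False using that by simp
      qed
      have "sqrt \<bar>y\<bar> \<le> W" using small[OF b1] W by (auto simp: y_def)
      hence yN: "\<bar>y\<bar> \<le> N" using N(1) real_sqrt_le_iff by metis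
      have "\<bar>z + q * y\<bar> \<le> W" using small[OF b2] W by (auto simp: y_def z_def)
      moreover have "\<bar>q * y\<bar> \<le> \<bar>q\<bar> * N" unfolding abs_mult using yN by (intro mult_left_mono) auto
      ultimately have "\<bar>z\<bar> \<le> W + \<bar>q\<bar> * N" by linarith
      hence box: "\<bar>z\<bar> \<le> R" "\<bar>y\<bar> \<le> R" using yN by (auto simp: R_def)
      have y0: "y \<noteq> 0" using diag[of x x'] Ge e by (auto simp: y_def)
      have "norm (G x x') \<le> K * (1 / sqrt \<bar>y\<bar>)"
        using b1[of x x'] y0 by (simp add: y_def field_simps)
      also have "1 / sqrt \<bar>y\<bar> = D R x x'"
        using box by (simp add: D_def u2_def y_def z_def indicator_def abs_le_iff)
      finally have "norm (G x x') \<le> K * D R x x'" .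
      moreover have "norm (f x') \<le> b" using b box by (auto simp: y_def z_def)
      ultimately have "norm (G x x' * f x') \<le> (K * D R x x') * b"
        unfolding norm_mult using K D0 by (intro mult_mono) auto
      moreover have "0 \<le> e * norm (f x')" using e by simp
      ultimately show ?thesis by (simp add: mult_ac)
    qed
    thus ?thesis using R by blast
  qed
  show int: "integrable lborel (\<lambda>x'. G x x' * f x')" for x
  proof -
    \<comment> \<open>For integrability \<open>e = 1\<close> suffices, with the global bound
      \<open>F\<close> of \<open>f\<close> in the role of \<open>b\<close>.\<close>
    obtain R where R: "R \<ge> 0" and *: "\<And>x x' b. (\<bar>fst x - fst x'\<bar> \<le> R \<longrightarrow> \<bar>snd x - snd x'\<bar> \<le> R \<longrightarrow> norm (f x') \<le> b) \<Longrightarrow> 0 \<le> b \<Longrightarrow>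
      norm (G x x' * f x') \<le> 1 * norm (f x') + K * b * D R x x'" using key[of 1] by fastforce
    show ?thesis
    proof (rule Bochner_Integration.integrable_bound)
      show "integrable lborel (\<lambda>x'. 1 * norm (f x') + K * F * D R x x')"
        using Di(1)[OF R, of x] f(1) by (intro Bochner_Integration.integrable_add integrable_mult_right integrable_norm)
      show "AE x' in lborel. norm (G x x' * f x') \<le> norm (1 * norm (f x') + K * F * D R x x')"
        unfolding real_norm_def[of "_ + _"]
        by (intro AE_I2 order_trans[OF _ abs_ge_self] *) (use f(3) F in auto)
    qed measurable
  qed
  show "((\<lambda>x. \<integral>x'. G x x' * f x' \<partial>lborel) \<longlongrightarrow> 0) at_infinity"
    unfolding Lim_at_infinity
  proof (intro allI impI)
    fix \<epsilon> :: real assume \<epsilon>: "\<epsilon> > 0"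
    define J where "J = (\<integral>x'. norm (f x') \<partial>lborel)"
    have J: "J \<ge> 0" by (simp add: J_def)
    define e where "e = \<epsilon> / (2 * (J + 1))"
    have e: "e > 0" "e * J < \<epsilon> / 2" using \<epsilon> J by (auto simp: e_def field_simps)
    obtain R where R: "R \<ge> 0" and *: "\<And>x x' b. (\<bar>fst x - fst x'\<bar> \<le> R \<longrightarrow> \<bar>snd x - snd x'\<bar> \<le> R \<longrightarrow> norm (f x') \<le> b) \<Longrightarrow> 0 \<le> b \<Longrightarrow>
      norm (G x x' * f x') \<le> e * norm (f x') + K * b * D R x x'" using key[OF e(1)] by blast
    have I: "I R \<ge> 0" unfolding Di(2)[OF R, of 0, symmetric] using D0 by (intro Bochner_Integration.integral_nonneg) auto
    \<comment> \<open>The tolerances \<open>e\<close> and \<open>b\<close> each account for less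
      than half of the target; the added 1 in their denominators also covers vanishing
      integrals.\<close>
    define b where "b = \<epsilon> / (2 * (K * I R + 1))"
    have KI: "K * I R \<ge> 0" using K I by simp
    hence b: "b > 0" "K * b * I R < \<epsilon> / 2" using \<epsilon> by (auto simp: b_def field_simps)
    from f(2) b(1) obtain M where M: "\<And>x. M \<le> norm x \<Longrightarrow> norm (f x) < b"
      unfolding Lim_at_infinity norm_conv_dist[symmetric] by blast
    have "dist (\<integral>x'. G x x' * f x' \<partial>lborel) 0 < \<epsilon>" if x: "M + 2 * R \<le> norm x" for x
    proof -
      have bnd: "norm (G x x' * f x') \<le> e * norm (f x') + K * b * D R x x'" for x'
      proof (rule *)
        show "\<bar>fst x - fst x'\<bar> \<le> R \<longrightarrow> \<bar>snd x - snd x'\<bar> \<le> R \<longrightarrow> norm (f x') \<le> b"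
        proof (intro impI)
          assume "\<bar>fst x - fst x'\<bar> \<le> R" "\<bar>snd x - snd x'\<bar> \<le> R"
          \<comment> \<open>Points of the box lie within \<open>2 * R\<close> of \<open>x\<close>,
            hence outside the radius beyond which \<open>f\<close> is below
            \<open>b\<close>.\<close>
          hence "norm (x - x') \<le> 2 * R"
            using norm_Pair_le[of "fst x - fst x'" "snd x - snd x'"] by (simp add: minus_prod_def)
          hence "M \<le> norm x'" using x norm_triangle_ineq2[of x x'] by linarith
          thus "norm (f x') \<le> b" using M by (simp add: less_imp_le)
        qed
      qed (use b in simp)
      have "norm (\<integral>x'. G x x' * f x' \<partial>lborel) \<le> (\<integral>x'. norm (G x x' * f x') \<partial>lborel)"
        by (rule integral_norm_bound)
      also have "\<dots> \<le> (\<integral>x'. e * norm (f x') + K * b * D R x x' \<partial>lborel)"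
        using Di(1)[OF R, of x] f(1) int bnd
        by (intro Bochner_Integration.integral_mono Bochner_Integration.integrable_add integrable_mult_right integrable_norm)
      also have "\<dots> = e * J + K * b * I R"
        using Di[OF R, of x] f(1) by (subst Bochner_Integration.integral_add) (auto simp: J_def)
      also have "\<dots> < \<epsilon>" using e b by linarith
      finally show ?thesis by simp
    qed
    thus "\<exists>B. \<forall>x. norm x \<ge> B \<longrightarrow> dist (\<integral>x'. G x x' * f x' \<partial>lborel) 0 < \<epsilon>" by blast
  qed
qed

text \<open>Weights of degree 0, 2 and 4 bound \<open>(1 + |x|^2)^2 |f x|\<close> for the Euclidean
  norm, and this weight dominates the product of \<open>1 + t^2\<close> over both coordinates, whose
  inverse is integrable.\<close>

lemma schwartz_decay:
  fixes f :: "real \<times> real \<Rightarrow> complex"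
  assumes "schwartz f"
  obtains B where "integrable lborel f" "(f \<longlongrightarrow> 0) at_infinity" "\<And>x. norm (f x) \<le> B"
proof -
  have diff: "f differentiable_on UNIV" and bd: "\<And>N::nat. bounded (range (\<lambda>x. norm x ^ N *\<^sub>R f x))"
    using assms unfolding schwartz_def by (auto dest: spec[of _ "[]"])
  have "\<exists>B. \<forall>x. norm x ^ N * norm (f x) \<le> B" for N
    using bd[of N] unfolding bounded_iff by auto
  then obtain B where B: "\<And>N x. norm x ^ N * norm (f x) \<le> B N" by metis
  have B0: "norm (f x) \<le> B 0" for x using B[of x 0] by simp
  have cont: "continuous_on UNIV f" by (rule differentiable_imp_continuous_on[OF diff])
  define C where "C = B 0 + 2 * B 2 + B 4"
  have le: "norm (f x) \<le> C * (inverse (1 + (fst x)\<^sup>2) * inverse (1 + (snd x)\<^sup>2))" for x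
  proof -
    have n: "(norm x)\<^sup>2 = (fst x)\<^sup>2 + (snd x)\<^sup>2" by (simp add: norm_prod_def)
    have p: "1 + t\<^sup>2 > 0" for t :: real by (simp add: add_pos_nonneg)
    have "norm (f x) * ((1 + (fst x)\<^sup>2) * (1 + (snd x)\<^sup>2)) \<le> norm (f x) * ((1 + (norm x)\<^sup>2) * (1 + (norm x)\<^sup>2))"
      unfolding n by (intro mult_left_mono mult_mono) auto
    also have "\<dots> = norm x ^ 0 * norm (f x) + 2 * (norm x ^ 2 * norm (f x)) + norm x ^ 4 * norm (f x)"
      by (simp add: algebra_simps power2_eq_square power4_eq_xxxx)
    also have "\<dots> \<le> C" unfolding C_def by (intro add_mono mult_left_mono B) auto
    finally have "norm (f x) \<le> C / ((1 + (fst x)\<^sup>2) * (1 + (snd x)\<^sup>2))"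
      using p[of "fst x"] p[of "snd x"] by (simp only: pos_le_divide_eq mult_pos_pos)
    thus ?thesis by (simp only: divide_inverse inverse_mult_distrib)
  qed
  have i1: "integrable lborel (\<lambda>t::real. inverse (1 + t\<^sup>2))"
    using integrable_inverse_1_plus_square by (simp add: set_integrable_def)
  have "integrable lborel f"
  proof (rule Bochner_Integration.integrable_bound)
    show "integrable lborel (\<lambda>x. C * (inverse (1 + (fst x)\<^sup>2) * inverse (1 + (snd x)\<^sup>2)))"
      by (intro integrable_mult_right integrable_lborel_prod_mult(1) i1)
    show "f \<in> borel_measurable lborel" using cont by (simp add: borel_measurable_continuous_onI)
    show "AE x in lborel. norm (f x) \<le> norm (C * (inverse (1 + (fst x)\<^sup>2) * inverse (1 + (snd x)\<^sup>2)))"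
      unfolding real_norm_def[of "_ * _"] by (intro AE_I2 order_trans[OF _ abs_ge_self] le)
  qed
  moreover have "(f \<longlongrightarrow> 0) at_infinity"
  proof (rule Lim_null_comparison)
    show "eventually (\<lambda>x. norm (f x) \<le> B 1 / norm x) at_infinity"
      unfolding eventually_at_infinity
    proof (intro exI[of _ 1] allI impI)
      fix x :: "real \<times> real" assume "1 \<le> norm x"
      hence "norm x > 0" by linarith
      thus "norm (f x) \<le> B 1 / norm x" using B[of x 1] by (simp add: pos_le_divide_eq mult.commute)
    qed
    show "((\<lambda>x::real \<times> real. B 1 / norm x) \<longlongrightarrow> 0) at_infinity"
      by (intro real_tendsto_divide_at_top[OF tendsto_const] filterlim_norm_at_top)
  qed
  ultimately show ?thesis using B0 that by blast
qed

theorem proposition2p1: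
  fixes k1 k2 a :: real
  assumes "k1 < k2" and "k1 \<noteq> 0" and "k2 \<noteq> 0" and "a > 0"
  shows "(\<exists>C::real. \<forall>(x :: real \<times> real) (x' :: real \<times> real) (l :: complex).
            snd x - snd x' \<noteq> 0 \<longrightarrow> l \<noteq> of_real k1 \<longrightarrow> l \<noteq> of_real k2 \<longrightarrow>
            norm (green k1 k2 a x x' l) \<le> C * (1 + 1 / sqrt \<bar>snd x - snd x'\<bar>))
       \<and> (\<forall>(f :: real \<times> real \<Rightarrow> complex) (l :: complex).
            schwartz f \<longrightarrow> l \<noteq> of_real k1 \<longrightarrow> l \<noteq> of_real k2 \<longrightarrow>
            (\<forall>x. integrable lborel (\<lambda>x'. green k1 k2 a x x' l * f x'))
            \<and> ((\<lambda>x. \<integral>x'. green k1 k2 a x x' l * f x' \<partial>lborel) \<longlongrightarrow> 0) at_infinity)"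
proof (intro conjI[OF _ allI[OF allI]] impI)
  note a = assms(4,2,3,1)
  obtain C where "\<And>x x' l. snd x \<noteq> snd x' \<Longrightarrow> l \<noteq> of_real k1 \<Longrightarrow> l \<noteq> of_real k2 \<Longrightarrow>
     norm (green k1 k2 a x x' l) \<le> C * (1 + 1 / sqrt \<bar>snd x - snd x'\<bar>)"
    using green_bounded[OF a] by blast
  thus "\<exists>C::real. \<forall>(x :: real \<times> real) (x' :: real \<times> real) (l :: complex).
            snd x - snd x' \<noteq> 0 \<longrightarrow> l \<noteq> of_real k1 \<longrightarrow> l \<noteq> of_real k2 \<longrightarrow>
            norm (green k1 k2 a x x' l) \<le> C * (1 + 1 / sqrt \<bar>snd x - snd x'\<bar>)"
    by (intro exI[of _ C]) auto
  fix f :: "real \<times> real \<Rightarrow> complex" and l :: complex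
  assume f: "schwartz f" and l: "l \<noteq> of_real k1" "l \<noteq> of_real k2"
  obtain K where K: "\<And>x x'. snd x \<noteq> snd x' \<Longrightarrow> norm (green k1 k2 a x x' l) * sqrt \<bar>snd x - snd x'\<bar> \<le> K"
    "\<And>x x'. snd x \<noteq> snd x' \<Longrightarrow> norm (green k1 k2 a x x' l) * \<bar>shear x x' l\<bar> \<le> K"
    using green_decay[OF a l] by blast
  note z = green_same_time[OF a l]
  \<comment> \<open>A sample pair of points shows \<open>K \<ge> 0\<close>, which extends the two
    decay estimates to the diagonal, where their left-hand sides vanish.\<close>
  have "0 \<le> norm (green k1 k2 a (0, 1) (0, 0) l) * sqrt \<bar>snd (0::real, 1::real) - snd (0::real, 0::real)\<bar>" by simp
  also have "\<dots> \<le> K" by (rule K(1)) simp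
  finally have K0: "0 \<le> K" .
  obtain B where B: "integrable lborel f" "(f \<longlongrightarrow> 0) at_infinity" "\<And>x. norm (f x) \<le> B"
    using schwartz_decay[OF f] by blast
  have b1: "norm (green k1 k2 a x x' l) * sqrt \<bar>snd x - snd x'\<bar> \<le> K" for x x'
    using K(1)[of x x'] K0 by (cases "snd x = snd x'") auto
  have b2: "norm (green k1 k2 a x x' l) * \<bar>fst x - fst x' + (2 * Re l) * (snd x - snd x')\<bar> \<le> K" for x x'
    using K(2)[of x x'] K0 z[of x x'] by (cases "snd x = snd x'") (auto simp: shear_def)
  note conv = weak_singular_convolution[where G = "\<lambda>x x'. green k1 k2 a x x' l", OF green_measurable[OF a l] z b1 b2 B]
  show "(\<forall>x. integrable lborel (\<lambda>x'. green k1 k2 a x x' l * f x'))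
     \<and> ((\<lambda>x. \<integral>x'. green k1 k2 a x x' l * f x' \<partial>lborel) \<longlongrightarrow> 0) at_infinity"
    using conv by blast
qed

end
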